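(* Let $\alpha\in(\tfrac12,1)$ and $\beta\in(0,1)$, and let $A,B\in\mathbb{R}^{n\times n}$ be non-permutable, i.e. $AB\neq BA$. Let $b,\sigma:[0,\infty)\times\mathbb{R}^n\to\mathbb{R}^n$ be measurable and bounded functions such that: (1) there exist $L_b,L_\sigma>0$ with $\|b(t,x)-b(t,y)\|\le L_b\|x-y\|$ and $\|\sigma(t,x)-\sigma(t,y)\|\le L_\sigma\|x-y\|$ for all $x,y\in\mathbb{R}^n$, $t\in[0,\infty)$; (2) for every $T>0$, $\int_0^T\|b(r,0)\|^2\,\mathrm{d}r<\infty$ and $\operatorname{ess\,sup}_{r\in[0,T]}\|\sigma(r,0)\|<\infty$. For $\eta\in\Xi_0$ let $\varphi(\cdot,\eta)$ denote the unique solution on $[0,\infty)$ (in the sense given in the context) of $$\left({}^{C}D^{\alpha}_{0^+}X\right)(t)-A\left({}^{C}D^{\beta}_{0^+}X\right)(t)-BX(t)=b(t,X(t))+\sigma(t,X(t))\frac{\mathrm{d}W(t)}{\mathrm{d}t},\qquad X(0)=\eta.$$ Let $\eta,\gamma\in\Xi_0$ be such that $\eta\neq\gamma$. Then for any $\epsilon>0$, $$\limsup_{t\to\infty}\,t^{\alpha+\epsilon}\,\|\varphi(t,\eta)-\varphi(t,\gamma)\|_{\mathrm{ms}}=\infty.$$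
   Context: $W=(W_t)_{t\ge0}$ is a standard scalar Brownian motion on a complete probability space $(\Omega,\mathscr{F},\mathbb{F},\mathbb{P})$ with filtration $\mathbb{F}=\{\mathscr{F}_t\}_{t\ge0}$. $\mathbb{R}^n$ carries the Euclidean norm $\|\cdot\|$. For each $t$, $\Xi_t:=\mathbb{L}^2(\Omega,\mathscr{F}_t,\mathbb{P})$ is the space of $\mathscr{F}_t$-measurable mean-square integrable $f:\Omega\to\mathbb{R}^n$, with $\|f\|_{\mathrm{ms}}:=(\mathbf{E}\|f\|^2)^{1/2}$; $\eta\neq\gamma$ means distinct as elements of $\Xi_0$. $H^2([0,T],\mathbb{R}^n)$ is the space of all measurable $\mathbb{F}$-adapted $\mathbb{R}^n$-valued processes $\xi$ on $[0,T]$ with $\sup_{t\in[0,T]}\mathbf{E}\|\xi(t)\|^2<\infty$. ${}^{C}D^{\alpha}_{0^+}$ denotes the Caputo fractional derivative of order $\alpha$. A solution (mild solution) on $[0,T]$ with initial value $\eta\in\Xi_0$ is a process $X\in H^2([0,T],\mathbb{R}^n)$ adapted to $\mathbb{F}$, with $\int_0^T\|X(t)\|^2\,\mathrm{d}t<\infty$ almost surely and with almost surely continuous paths, satisfying on $[0,T]$ $$X(t)=\eta-\frac{At^{\alpha-\beta}}{\Gamma(\alpha-\beta+1)}\eta+\frac{A}{\Gamma(\alpha-\beta)}\int_0^t(t-r)^{\alpha-\beta-1}X(r)\,\mathrm{d}r+\frac{B}{\Gamma(\alpha)}\int_0^t(t-r)^{\alpha-1}X(r)\,\mathrm{d}r$$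 $$\qquad+\frac{1}{\Gamma(\alpha)}\int_0^t(t-r)^{\alpha-1}b(r,X(r))\,\mathrm{d}r+\frac{1}{\Gamma(\alpha)}\int_0^t(t-r)^{\alpha-1}\sigma(r,X(r))\,\mathrm{d}W(r),$$ the last integral being an Itô integral. The source asserts that under (1) and (2) there is, for each $T>0$, exactly one solution on $[0,T]$ in $H^2([0,T],\mathbb{R}^n)$; $\varphi(\cdot,\eta)$ on $[0,\infty)$ is the process whose restriction to each $[0,T]$ is this solution. *)

theory Defs
  imports "HOL-Probability.Probability"
begin

locale brownian_basis = prob_space M + complete_measure M
  for M :: "'w measure" +
  fixes F :: "real \<Rightarrow> 'w measure"
    and W :: "real \<Rightarrow> 'w \<Rightarrow> real"
  assumes filtration_sub: "\<And>t. 0 \<le> t \<Longrightarrow> subalgebra M (F t)"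
    and filtration_mono: "\<And>s t. 0 \<le> s \<Longrightarrow> s \<le> t \<Longrightarrow> subalgebra (F t) (F s)"
    and BM_zero: "AE \<omega> in M. W 0 \<omega> = 0"
    and BM_adapted: "\<And>t. 0 \<le> t \<Longrightarrow> W t \<in> borel_measurable (F t)"
    and BM_normal: "\<And>s t. 0 \<le> s \<Longrightarrow> s < t \<Longrightarrow>
      distributed M lborel (\<lambda>\<omega>. W t \<omega> - W s \<omega>) (\<lambda>x. ennreal (normal_density 0 (sqrt (t - s)) x))"
    and BM_indep: "\<And>s t. 0 \<le> s \<Longrightarrow> s < t \<Longrightarrow>
      indep_set (sets (F s)) {(\<lambda>\<omega>. W t \<omega> - W s \<omega>) -` S \<inter> space M | S. S \<in> sets borel}"
    and BM_continuous: "AE \<omega> in M. continuous_on {0..} (\<lambda>t. W t \<omega>)"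

definition Xi :: "'w measure \<Rightarrow> (real \<Rightarrow> 'w measure) \<Rightarrow> real \<Rightarrow> ('w \<Rightarrow> 'b::euclidean_space) set" where
  "Xi M F t = {f. f \<in> borel_measurable (F t) \<and> integrable M (\<lambda>\<omega>. (norm (f \<omega>))\<^sup>2)}"

definition ms_norm :: "'w measure \<Rightarrow> ('w \<Rightarrow> 'b::euclidean_space) \<Rightarrow> real" where
  "ms_norm M f = sqrt (LINT \<omega>|M. (norm (f \<omega>))\<^sup>2)"

definition measurable_adapted ::
  "'w measure \<Rightarrow> (real \<Rightarrow> 'w measure) \<Rightarrow> real \<Rightarrow> (real \<Rightarrow> 'w \<Rightarrow> 'b::euclidean_space) \<Rightarrow> bool" where
  "measurable_adapted M F T X \<longleftrightarrow>
     (\<lambda>(t, \<omega>). X t \<omega>) \<in> borel_measurable (restrict_space borel {0..T} \<Otimes>\<^sub>M M) \<and>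
     (\<forall>t\<in>{0..T}. X t \<in> borel_measurable (F t))"

definition H2 ::
  "'w measure \<Rightarrow> (real \<Rightarrow> 'w measure) \<Rightarrow> real \<Rightarrow> (real \<Rightarrow> 'w \<Rightarrow> 'b::euclidean_space) set" where
  "H2 M F T = {X. measurable_adapted M F T X \<and>
     (SUP t\<in>{0..T}. \<integral>\<^sup>+\<omega>. ennreal ((norm (X t \<omega>))\<^sup>2) \<partial>M) < \<infinity>}"

text \<open>A simple integrand on \<open>[0,T]\<close> is given by partition points \<open>\<tau> 0 \<le> \<dots> \<le> \<tau> k\<close> in \<open>[0,T]\<close>
  and bounded \<open>F (\<tau> i)\<close>-measurable values \<open>\<xi> i\<close> on \<open>(\<tau> i, \<tau> (i+1)]\<close>.\<close>

definition simple_integrand ::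
  "'w measure \<Rightarrow> (real \<Rightarrow> 'w measure) \<Rightarrow> real \<Rightarrow> nat \<Rightarrow> (nat \<Rightarrow> real) \<Rightarrow> (nat \<Rightarrow> 'w \<Rightarrow> 'b::euclidean_space) \<Rightarrow> bool" where
  "simple_integrand M F T k \<tau> \<xi> \<longleftrightarrow>
     0 \<le> \<tau> 0 \<and> (\<forall>i<k. \<tau> i \<le> \<tau> (Suc i)) \<and> \<tau> k \<le> T \<and>
     (\<forall>i<k. \<xi> i \<in> borel_measurable (F (\<tau> i)) \<and> bounded (\<xi> i ` space M))"

definition simple_process ::
  "nat \<Rightarrow> (nat \<Rightarrow> real) \<Rightarrow> (nat \<Rightarrow> 'w \<Rightarrow> 'b::euclidean_space) \<Rightarrow> real \<Rightarrow> 'w \<Rightarrow> 'b" where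
  "simple_process k \<tau> \<xi> t \<omega> = (\<Sum>i<k. indicator {\<tau> i<..\<tau> (Suc i)} t *\<^sub>R \<xi> i \<omega>)"

definition simple_integral ::
  "(real \<Rightarrow> 'w \<Rightarrow> real) \<Rightarrow> nat \<Rightarrow> (nat \<Rightarrow> real) \<Rightarrow> (nat \<Rightarrow> 'w \<Rightarrow> 'b::euclidean_space) \<Rightarrow> 'w \<Rightarrow> 'b" where
  "simple_integral W k \<tau> \<xi> \<omega> = (\<Sum>i<k. (W (\<tau> (Suc i)) \<omega> - W (\<tau> i) \<omega>) *\<^sub>R \<xi> i \<omega>)"

text \<open>\<open>I\<close> is (a version of) the It\^o integral of \<open>f\<close> over \<open>[0,T]\<close>: the mean-square limit of the
  integrals of simple integrands converging to \<open>f\<close> in \<open>L\<^sup>2([0,T] \<times> \<Omega>)\<close>. By the It\^o isometry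
  this determines \<open>I\<close> up to almost sure equality, which is why it is stated as a relation.\<close>

definition has_ito_integral ::
  "'w measure \<Rightarrow> (real \<Rightarrow> 'w measure) \<Rightarrow> (real \<Rightarrow> 'w \<Rightarrow> real) \<Rightarrow> real \<Rightarrow>
   (real \<Rightarrow> 'w \<Rightarrow> 'b::euclidean_space) \<Rightarrow> ('w \<Rightarrow> 'b) \<Rightarrow> bool" where
  "has_ito_integral M F W T f I \<longleftrightarrow>
     measurable_adapted M F T f \<and> I \<in> borel_measurable M \<and>
     (\<exists>k \<tau> \<xi>. (\<forall>m. simple_integrand M F T (k m) (\<tau> m) (\<xi> m)) \<and>
       (\<lambda>m. \<integral>\<^sup>+\<omega>. (\<integral>\<^sup>+t\<in>{0..T}. ennreal ((norm (f t \<omega> - simple_process (k m) (\<tau> m) (\<xi> m) t \<omega>))\<^sup>2) \<partial>lborel) \<partial>M)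
         \<longlonglongrightarrow> 0 \<and>
       (\<lambda>m. \<integral>\<^sup>+\<omega>. ennreal ((norm (I \<omega> - simple_integral W (k m) (\<tau> m) (\<xi> m) \<omega>))\<^sup>2) \<partial>M) \<longlonglongrightarrow> 0)"

text \<open>The Caputo equation
  \<open>D\<^sup>\<alpha> X - A D\<^sup>\<beta> X - B X = b(t,X) + \<sigma>(t,X) dW/dt\<close>, \<open>X(0) = \<eta>\<close>, is understood in its mild form.
  The convergence of the pathwise integrals is demanded explicitly, because the Lebesgue integral
  of a non-integrable function is \<open>0\<close> by convention; in particular the kernel
  \<open>(t - r) powr (\<alpha> - \<beta> - 1)\<close> is not integrable at \<open>r = t\<close> when \<open>\<alpha> \<le> \<beta>\<close>.
  As the stochastic convolution is an It\^o integral for each fixed \<open>t\<close>, the identity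
  is almost sure for each \<open>t\<close>.\<close>

definition mild_solution_on ::
  "'w measure \<Rightarrow> (real \<Rightarrow> 'w measure) \<Rightarrow> (real \<Rightarrow> 'w \<Rightarrow> real) \<Rightarrow> real \<Rightarrow> real \<Rightarrow>
   real^'n^'n \<Rightarrow> real^'n^'n \<Rightarrow> (real \<Rightarrow> real^'n \<Rightarrow> real^'n) \<Rightarrow> (real \<Rightarrow> real^'n \<Rightarrow> real^'n) \<Rightarrow>
   ('w \<Rightarrow> real^'n) \<Rightarrow> real \<Rightarrow> (real \<Rightarrow> 'w \<Rightarrow> real^'n) \<Rightarrow> bool" where
  "mild_solution_on M F W \<alpha> \<beta> A B b \<sigma> \<eta> T X \<longleftrightarrow>
     X \<in> H2 M F T \<and>
     (AE \<omega> in M. (\<integral>\<^sup>+t\<in>{0..T}. ennreal ((norm (X t \<omega>))\<^sup>2) \<partial>lborel) < \<infinity>) \<and>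
     (AE \<omega> in M. continuous_on {0..T} (\<lambda>t. X t \<omega>)) \<and>
     (\<forall>t\<in>{0..T}. \<exists>I.
        has_ito_integral M F W t (\<lambda>r \<omega>. (t - r) powr (\<alpha> - 1) *\<^sub>R \<sigma> r (X r \<omega>)) I \<and>
        (AE \<omega> in M.
           set_integrable lborel {0..t} (\<lambda>r. (t - r) powr (\<alpha> - \<beta> - 1) *\<^sub>R X r \<omega>) \<and>
           set_integrable lborel {0..t} (\<lambda>r. (t - r) powr (\<alpha> - 1) *\<^sub>R X r \<omega>) \<and>
           set_integrable lborel {0..t} (\<lambda>r. (t - r) powr (\<alpha> - 1) *\<^sub>R b r (X r \<omega>)) \<and>
           X t \<omega> = \<eta> \<omega>
             - (t powr (\<alpha> - \<beta>) / Gamma (\<alpha> - \<beta> + 1)) *\<^sub>R (A *v \<eta> \<omega>)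
             + (1 / Gamma (\<alpha> - \<beta>)) *\<^sub>R (A *v (LINT r:{0..t}|lborel. (t - r) powr (\<alpha> - \<beta> - 1) *\<^sub>R X r \<omega>))
             + (1 / Gamma \<alpha>) *\<^sub>R (B *v (LINT r:{0..t}|lborel. (t - r) powr (\<alpha> - 1) *\<^sub>R X r \<omega>))
             + (1 / Gamma \<alpha>) *\<^sub>R (LINT r:{0..t}|lborel. (t - r) powr (\<alpha> - 1) *\<^sub>R b r (X r \<omega>))
             + (1 / Gamma \<alpha>) *\<^sub>R I \<omega>))"

definition mild_solution ::
  "'w measure \<Rightarrow> (real \<Rightarrow> 'w measure) \<Rightarrow> (real \<Rightarrow> 'w \<Rightarrow> real) \<Rightarrow> real \<Rightarrow> real \<Rightarrow>
   real^'n^'n \<Rightarrow> real^'n^'n \<Rightarrow> (real \<Rightarrow> real^'n \<Rightarrow> real^'n) \<Rightarrow> (real \<Rightarrow> real^'n \<Rightarrow> real^'n) \<Rightarrow>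
   ('w \<Rightarrow> real^'n) \<Rightarrow> (real \<Rightarrow> 'w \<Rightarrow> real^'n) \<Rightarrow> bool" where
  "mild_solution M F W \<alpha> \<beta> A B b \<sigma> \<eta> X \<longleftrightarrow>
     (\<forall>T>0. mild_solution_on M F W \<alpha> \<beta> A B b \<sigma> \<eta> T X)"

end

theory Submission
  imports Defs
begin

text \<open>
  Suppose the upper limit is finite. Then \<open>D t = \<phi> \<eta> t - \<phi> \<gamma> t\<close> decays in mean like
  \<open>t powr (- l)\<close> for some \<open>l\<close> with \<open>\<alpha> < l < 1\<close>. Put \<open>\<delta> = \<eta> - \<gamma>\<close> and \<open>a = \<alpha> - \<beta>\<close>, and subtract the
  two mild equations at time \<open>t\<close>: the variable
  \<open>\<delta> - (t powr a / Gamma (a + 1)) *\<^sub>R (A *v \<delta>)\<close> equals \<open>D t\<close> minus Abel convolutions of orders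
  \<open>a\<close> and \<open>\<alpha>\<close> of differences bounded by multiples of \<open>D\<close>, minus a difference of It\^o
  integrals.

  The initial values are known at time \<open>0\<close>, and It\^o integrals are orthogonal to everything
  known at time \<open>0\<close> (\<open>ito_integral_orthogonal\<close>). So pair the identity with the bounded initial
  variable \<open>\<zeta> = sgn \<delta>\<close>: the noise disappears. A kernel of order \<open>p < l\<close> maps a decay of order \<open>l\<close> to a decay of
  order \<open>l - p\<close> (\<open>abel_convolution_L1\<close>), so the remaining terms vanish as \<open>t\<close> grows
  (\<open>projected_difference_bound\<close>).

  Let \<open>p\<close> be the expectation of \<open>\<delta> \<bullet> \<zeta>\<close>, that is, of \<open>norm \<delta>\<close>. If \<open>\<beta> < \<alpha>\<close>, the preceding says that
  \<open>p - t powr a * q\<close> tends to \<open>0\<close> for some constant \<open>q\<close>. As \<open>a > 0\<close>, first \<open>q = 0\<close> and then \<open>p = 0\<close>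
  (\<open>power_balance_zero\<close>), so \<open>\<eta> = \<gamma>\<close> almost surely, a contradiction.

  If \<open>\<alpha> \<le> \<beta>\<close>, the kernel \<open>(t - r) powr (\<alpha> - \<beta> - 1)\<close> is not integrable at \<open>r = t\<close>, and a
  continuous mild solution can only be zero (\<open>singular_kernel_forces_zero\<close>). The equation at
  \<open>t = 0\<close>, paired with \<open>\<zeta>\<close>, then yields \<open>p = 0\<close> once more.
\<close>

section \<open>First moments on a probability space\<close>

text \<open>
  On a probability space the first moment is dominated by the mean-square norm, because the
  variance of the norm is nonnegative. It lets every estimate below be carried out for first moments.
\<close>

lemma (in prob_space) L1_le_L2:
  fixes f :: "'a \<Rightarrow> 'b::euclidean_space"
  assumes [measurable]: "f \<in> borel_measurable M"
    and sq: "integrable M (\<lambda>\<omega>. (norm (f \<omega>))\<^sup>2)"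
  shows "integrable M f" "expectation (\<lambda>\<omega>. norm (f \<omega>)) \<le> ms_norm M f"
proof -
  have n: "integrable M (\<lambda>\<omega>. norm (f \<omega>))"
    by (rule square_integrable_imp_integrable[OF _ sq]) simp
  then show "integrable M f"
    by (simp add: integrable_norm_iff)
  have "0 \<le> variance (\<lambda>\<omega>. norm (f \<omega>))"
    by (rule variance_positive)
  also have "\<dots> = expectation (\<lambda>\<omega>. (norm (f \<omega>))\<^sup>2) - (expectation (\<lambda>\<omega>. norm (f \<omega>)))\<^sup>2"
    by (rule variance_eq[OF n sq])
  finally show "expectation (\<lambda>\<omega>. norm (f \<omega>)) \<le> ms_norm M f"
    unfolding ms_norm_def by (intro real_le_rsqrt) simp
qed

lemma (in prob_space) integrable_inner_bounded:
  fixes f \<zeta> :: "'a \<Rightarrow> 'b::euclidean_space"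
  assumes f: "integrable M f" and \<zeta>: "\<zeta> \<in> borel_measurable M"
    and C: "\<And>\<omega>. \<omega> \<in> space M \<Longrightarrow> norm (\<zeta> \<omega>) \<le> C"
  shows "integrable M (\<lambda>\<omega>. f \<omega> \<bullet> \<zeta> \<omega>)"
    and "\<bar>expectation (\<lambda>\<omega>. f \<omega> \<bullet> \<zeta> \<omega>)\<bar> \<le> C * expectation (\<lambda>\<omega>. norm (f \<omega>))"
proof -
  have le: "norm (f \<omega> \<bullet> \<zeta> \<omega>) \<le> C * norm (f \<omega>)" if "\<omega> \<in> space M" for \<omega>
  proof -
    have "norm (f \<omega> \<bullet> \<zeta> \<omega>) \<le> norm (f \<omega>) * norm (\<zeta> \<omega>)"
      using Cauchy_Schwarz_ineq2[of "f \<omega>"] by simp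
    also have "\<dots> \<le> norm (f \<omega>) * C" using C[OF that] by (rule mult_left_mono) simp
    finally show ?thesis by (simp add: mult.commute)
  qed
  have iC: "integrable M (\<lambda>\<omega>. C * norm (f \<omega>))" using f by simp
  show i: "integrable M (\<lambda>\<omega>. f \<omega> \<bullet> \<zeta> \<omega>)"
    by (rule Bochner_Integration.integrable_bound[OF iC])
      (use f \<zeta> in \<open>auto intro!: AE_I2 order_trans[OF le[unfolded real_norm_def]]\<close>)
  have "norm (expectation (\<lambda>\<omega>. f \<omega> \<bullet> \<zeta> \<omega>)) \<le> expectation (\<lambda>\<omega>. C * norm (f \<omega>))"
    using le by (intro order_trans[OF integral_norm_bound integral_mono[OF integrable_norm[OF i] iC]])
  then show "\<bar>expectation (\<lambda>\<omega>. f \<omega> \<bullet> \<zeta> \<omega>)\<bar> \<le> C * expectation (\<lambda>\<omega>. norm (f \<omega>))"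
    by simp
qed

lemma difference_square_integrable:
  fixes X Y :: "'w \<Rightarrow> 'b::euclidean_space"
  assumes [measurable]: "X \<in> borel_measurable M" "Y \<in> borel_measurable M"
    and X: "(\<integral>\<^sup>+\<omega>. ennreal ((norm (X \<omega>))\<^sup>2) \<partial>M) \<le> ennreal S"
    and Y: "(\<integral>\<^sup>+\<omega>. ennreal ((norm (Y \<omega>))\<^sup>2) \<partial>M) \<le> ennreal S'"
  shows "integrable M (\<lambda>\<omega>. (norm (X \<omega> - Y \<omega>))\<^sup>2)"
proof (rule Bochner_Integration.integrable_bound)
  show "integrable M (\<lambda>\<omega>. 2 * (norm (X \<omega>))\<^sup>2 + 2 * (norm (Y \<omega>))\<^sup>2)"
    using X Y by (intro Bochner_Integration.integrable_add integrable_mult_right integrableI_bounded)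
      (auto intro: le_less_trans)
  show "AE \<omega> in M. norm ((norm (X \<omega> - Y \<omega>))\<^sup>2) \<le> norm (2 * (norm (X \<omega>))\<^sup>2 + 2 * (norm (Y \<omega>))\<^sup>2)"
  proof (rule AE_I2)
    fix \<omega>
    have "(norm (X \<omega> - Y \<omega>))\<^sup>2 \<le> (norm (X \<omega>) + norm (Y \<omega>))\<^sup>2"
      by (intro power_mono norm_triangle_ineq4) simp
    also have "\<dots> \<le> 2 * (norm (X \<omega>))\<^sup>2 + 2 * (norm (Y \<omega>))\<^sup>2"
      using sum_squares_bound[of "norm (X \<omega>)" "norm (Y \<omega>)"] by (simp add: power2_sum)
    finally show "norm ((norm (X \<omega> - Y \<omega>))\<^sup>2) \<le> norm (2 * (norm (X \<omega>))\<^sup>2 + 2 * (norm (Y \<omega>))\<^sup>2)"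
      by simp
  qed
qed simp

section \<open>Convolution with Abel kernels\<close>

text \<open>
  Substituting \<open>r = t s\<close> turns the convolution of two powers on \<open>[0,t]\<close> into Euler's Beta
  integral. The right-hand side decays in \<open>t\<close> precisely when \<open>p < l\<close>.
\<close>

lemma abel_integral:
  fixes p l t :: real
  assumes "0 < p" "l < 1" and t: "0 < t"
  shows "(\<integral>\<^sup>+r\<in>{0..t}. ennreal ((t - r) powr (p - 1) * r powr (- l)) \<partial>lborel)
    = ennreal (t powr (p - l) * Beta (1 - l) p)"
proof -
  let ?J = "Beta (1 - l) p"
  have J0: "0 \<le> ?J" using assms by (simp add: Beta_def)
  have beta: "(\<integral>\<^sup>+s\<in>{0..1}. ennreal (s powr (- l) * (1 - s) powr (p - 1)) \<partial>lborel) = ennreal ?J"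
    using has_integral_Beta_real[of "1 - l" p] assms
    by (subst nn_integral_has_integral_lebesgue[symmetric, where f = "\<lambda>s. s powr (- l) * (1 - s) powr (p - 1)" and \<Omega> = "{0..1}"])
       (auto intro!: nn_integral_cong simp: indicator_def)
  have "(\<integral>\<^sup>+r\<in>{0..t}. ennreal ((t - r) powr (p - 1) * r powr (- l)) \<partial>lborel)
    = ennreal t * (\<integral>\<^sup>+s. ennreal ((t - t * s) powr (p - 1) * (t * s) powr (- l)) * indicator {0..t} (t * s) \<partial>lborel)"
    using t by (subst nn_integral_real_affine[where c = t and t = 0]) auto
  also have "\<dots> = ennreal t * (\<integral>\<^sup>+s. ennreal (t powr (p - 1 - l)) * (ennreal (s powr (- l) * (1 - s) powr (p - 1)) * indicator {0..1} s) \<partial>lborel)"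
  proof (rule arg_cong[where f = "(*) (ennreal t)"], rule nn_integral_cong)
    fix s :: real
    show "ennreal ((t - t * s) powr (p - 1) * (t * s) powr (- l)) * indicator {0..t} (t * s)
      = ennreal (t powr (p - 1 - l)) * (ennreal (s powr (- l) * (1 - s) powr (p - 1)) * indicator {0..1} s)"
    proof (cases "0 \<le> s \<and> s \<le> 1")
      case True
      have "(t - t * s) powr (p - 1) = t powr (p - 1) * (1 - s) powr (p - 1)"
        using t True by (subst powr_mult[symmetric]) (auto simp: algebra_simps)
      moreover have "(t * s) powr (- l) = t powr (- l) * s powr (- l)"
        using t True by (simp add: powr_mult)
      moreover have "t powr (p - 1 - l) = t powr (p - 1) * t powr (- l)"
        by (simp flip: powr_add)
      moreover have "t * s \<le> t" using t True by (simp add: mult_left_le)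
      ultimately show ?thesis using True t
        by (simp add: ennreal_mult'[symmetric] mult_ac)
    next
      case False
      then have "t * s \<notin> {0..t}" using t by (auto simp: zero_le_mult_iff)
      with False show ?thesis by auto
    qed
  qed
  also have "\<dots> = ennreal t * (ennreal (t powr (p - 1 - l)) * ennreal ?J)"
    by (subst nn_integral_cmult) (auto simp: beta)
  also have "\<dots> = ennreal (t powr (p - l) * ?J)"
    using t J0 by (simp add: ennreal_mult'[symmetric] powr_diff)
  finally show ?thesis .
qed

text \<open>
  By Tonelli's theorem the expectation may be taken inside the time integral; the decay of
  the first moments of \<open>X\<close> then reduces the claim to the Beta integral.
\<close>

lemma (in prob_space) abel_convolution_L1:
  fixes X :: "real \<Rightarrow> 'a \<Rightarrow> 'b::euclidean_space"
  assumes X: "(\<lambda>(r, \<omega>). X r \<omega>) \<in> borel_measurable (restrict_space borel {0..t} \<Otimes>\<^sub>M M)"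
    and p: "0 < p" and l: "l < 1" and t: "0 < t" and C: "0 \<le> C"
    and bd: "\<And>r. 0 < r \<Longrightarrow> r \<le> t \<Longrightarrow> (\<integral>\<^sup>+\<omega>. ennreal (norm (X r \<omega>)) \<partial>M) \<le> ennreal (C * r powr (- l))"
  shows "(\<lambda>\<omega>. \<integral>\<^sup>+r\<in>{0..t}. ennreal ((t - r) powr (p - 1) * norm (X r \<omega>)) \<partial>lborel) \<in> borel_measurable M" (is "?I \<in> _")
    and "(\<integral>\<^sup>+\<omega>. (\<integral>\<^sup>+r\<in>{0..t}. ennreal ((t - r) powr (p - 1) * norm (X r \<omega>)) \<partial>lborel) \<partial>M)
      \<le> ennreal (C * Beta (1 - l) p * t powr (p - l))"
proof -
  let ?N = "restrict_space lborel {0..t}"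
  interpret N: sigma_finite_measure ?N
    by (rule sigma_finite_measure_restrict_space[OF lborel.sigma_finite_measure_axioms]) simp
  interpret pair_sigma_finite ?N M ..
  have sN: "sets (?N \<Otimes>\<^sub>M M) = sets (restrict_space borel {0..t} \<Otimes>\<^sub>M M)"
    by (intro sets_pair_measure_cong sets_restrict_space_cong) simp_all
  have Xp[measurable]: "(\<lambda>z. X (fst z) (snd z)) \<in> borel_measurable (?N \<Otimes>\<^sub>M M)"
    using X by (simp add: measurable_cong_sets[OF sN refl] split_beta')
  have [measurable]: "(\<lambda>r. r) \<in> borel_measurable ?N"
    by (rule measurable_restrict_space1) simp
  have f: "(\<lambda>(r, \<omega>). ennreal ((t - r) powr (p - 1) * norm (X r \<omega>))) \<in> borel_measurable (?N \<Otimes>\<^sub>M M)"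
    unfolding split_beta' by measurable
  have Ieq: "?I \<omega> = (\<integral>\<^sup>+r. ennreal ((t - r) powr (p - 1) * norm (X r \<omega>)) \<partial>?N)" for \<omega>
    by (subst nn_integral_restrict_space) simp_all
  have "(\<lambda>(\<omega>, r). ennreal ((t - r) powr (p - 1) * norm (X r \<omega>))) \<in> borel_measurable (M \<Otimes>\<^sub>M ?N)"
    using measurable_pair_swap[OF f] by (simp add: split_beta')
  then show "?I \<in> borel_measurable M"
    unfolding Ieq by (intro N.borel_measurable_nn_integral) 
  have "(\<integral>\<^sup>+\<omega>. ?I \<omega> \<partial>M) = (\<integral>\<^sup>+r. (\<integral>\<^sup>+\<omega>. ennreal ((t - r) powr (p - 1) * norm (X r \<omega>)) \<partial>M) \<partial>?N)"
    unfolding Ieq by (rule Fubini'[OF f])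
  also have "\<dots> = (\<integral>\<^sup>+r. (\<integral>\<^sup>+\<omega>. ennreal ((t - r) powr (p - 1) * norm (X r \<omega>)) \<partial>M) * indicator {0..t} r \<partial>lborel)"
    by (rule nn_integral_restrict_space) simp
  also have "\<dots> \<le> (\<integral>\<^sup>+r. ennreal C * (ennreal ((t - r) powr (p - 1) * r powr (- l)) * indicator {0..t} r) \<partial>lborel)"
  proof (rule nn_integral_mono_AE)
    \<comment> \<open>The null set \<open>r = 0\<close> is discarded: \<open>0 powr (- l) = 0\<close> bounds nothing there.\<close>
    have "AE r in lborel. r \<noteq> (0::real)" by (rule AE_lborel_singleton)
    then show "AE r in lborel. (\<integral>\<^sup>+\<omega>. ennreal ((t - r) powr (p - 1) * norm (X r \<omega>)) \<partial>M) * indicator {0..t} r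
        \<le> ennreal C * (ennreal ((t - r) powr (p - 1) * r powr (- l)) * indicator {0..t} r)"
    proof (rule AE_mp, intro AE_I2 impI)
      fix r :: real assume "r \<noteq> 0"
      show "(\<integral>\<^sup>+\<omega>. ennreal ((t - r) powr (p - 1) * norm (X r \<omega>)) \<partial>M) * indicator {0..t} r
        \<le> ennreal C * (ennreal ((t - r) powr (p - 1) * r powr (- l)) * indicator {0..t} r)"
      proof (cases "r \<in> {0..t}")
        case True
        then have r: "0 < r" "r \<le> t" using \<open>r \<noteq> 0\<close> by auto
        then have "r \<in> space ?N" by (simp add: space_restrict_space)
        then have [measurable]: "X r \<in> borel_measurable M"
          using measurable_compose[OF measurable_Pair1'[OF \<open>r \<in> space ?N\<close>] Xp] by simp
        have "(\<integral>\<^sup>+\<omega>. ennreal ((t - r) powr (p - 1) * norm (X r \<omega>)) \<partial>M)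
            = ennreal ((t - r) powr (p - 1)) * (\<integral>\<^sup>+\<omega>. ennreal (norm (X r \<omega>)) \<partial>M)"
          by (subst nn_integral_cmult[symmetric]) (auto simp: ennreal_mult')
        also have "\<dots> \<le> ennreal ((t - r) powr (p - 1)) * ennreal (C * r powr (- l))"
          by (intro mult_left_mono bd r) simp
        finally show ?thesis using True C by (simp add: ennreal_mult'[symmetric] mult_ac)
      qed simp
    qed
  qed
  also have "\<dots> = ennreal C * ennreal (t powr (p - l) * Beta (1 - l) p)"
    by (subst nn_integral_cmult) (simp_all add: abel_integral[OF p l t])
  also have "\<dots> = ennreal (C * Beta (1 - l) p * t powr (p - l))"
    using C by (simp add: ennreal_mult'[symmetric] mult_ac)
  finally show "(\<integral>\<^sup>+\<omega>. ?I \<omega> \<partial>M) \<le> ennreal (C * Beta (1 - l) p * t powr (p - l))" .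
qed

text \<open>
  The upper bound is a Lebesgue integral of nonnegative functions, so that it can later be
  averaged over the probability space by Tonelli's theorem. The second pair \<open>u\<close>, \<open>v\<close> serves
  the drift, whose differences are controlled by those of the solutions themselves.
\<close>

lemma set_integral_diff_bound:
  fixes f g u v :: "real \<Rightarrow> 'b::euclidean_space"
  assumes f: "set_integrable lborel S f" and g: "set_integrable lborel S g"
    and u: "set_integrable lborel S u" and v: "set_integrable lborel S v"
    and K: "0 \<le> K" and le: "\<And>r. r \<in> S \<Longrightarrow> norm (f r - g r) \<le> K * norm (u r - v r)"
  shows "ennreal (norm ((LINT r:S|lborel. f r) - (LINT r:S|lborel. g r)))
    \<le> ennreal K * (\<integral>\<^sup>+r\<in>S. ennreal (norm (u r - v r)) \<partial>lborel)"
proof -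
  have uv: "integrable lborel (\<lambda>r. indicator S r *\<^sub>R (u r - v r))"
    using set_integral_diff(1)[OF u v] by (simp add: set_integrable_def)
  have "ennreal (norm ((LINT r:S|lborel. f r) - (LINT r:S|lborel. g r)))
      = ennreal (norm (LINT r|lborel. indicator S r *\<^sub>R (f r - g r)))"
    using set_integral_diff(2)[OF f g] by (simp add: set_lebesgue_integral_def)
  also have "\<dots> \<le> (\<integral>\<^sup>+r. norm (indicator S r *\<^sub>R (f r - g r)) \<partial>lborel)"
    using set_integral_diff(1)[OF f g] unfolding set_integrable_def by (rule integral_norm_bound_ennreal)
  also have "\<dots> \<le> (\<integral>\<^sup>+r. ennreal K * ennreal (norm (indicator S r *\<^sub>R (u r - v r))) \<partial>lborel)"
    using le K by (intro nn_integral_mono) (auto simp: indicator_def ennreal_mult'[symmetric] intro!: ennreal_leI)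
  also have "\<dots> = ennreal K * (\<integral>\<^sup>+r. ennreal (norm (indicator S r *\<^sub>R (u r - v r))) \<partial>lborel)"
    by (intro nn_integral_cmult measurable_compose[OF _ measurable_ennreal]
        borel_measurable_integrable[OF integrable_norm[OF uv]])
  also have "(\<integral>\<^sup>+r. ennreal (norm (indicator S r *\<^sub>R (u r - v r))) \<partial>lborel)
      = (\<integral>\<^sup>+r\<in>S. ennreal (norm (u r - v r)) \<partial>lborel)"
    by (intro nn_integral_cong) (auto simp: indicator_def)
  finally show ?thesis .
qed

text \<open>
  If \<open>X t\<close> were nonzero then \<open>X\<close> would stay away from zero near \<open>t\<close>, and the integral would
  dominate a multiple of \<open>\<integral> dr / (t - r)\<close>, which diverges logarithmically at \<open>r = t\<close>.
\<close>

lemma singular_kernel_forces_zero: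
  fixes X :: "real \<Rightarrow> 'b::euclidean_space"
  assumes t: "0 < t" and q: "q \<le> -1" and X: "continuous_on {0..t} X"
    and int: "set_integrable lborel {0..t} (\<lambda>r. (t - r) powr q *\<^sub>R X r)"
  shows "X t = 0"
proof (rule ccontr)
  assume nz: "X t \<noteq> 0"
  define c where "c = norm (X t) / 2"
  have c: "0 < c" using nz by (simp add: c_def)
  obtain d where d: "0 < d" "\<And>r. r \<in> {0..t} \<Longrightarrow> dist r t < d \<Longrightarrow> dist (X r) (X t) < c"
    using X t c unfolding continuous_on_iff by (metis atLeastAtMost_iff less_eq_real_def)
  \<comment> \<open>The radius stays below \<open>1\<close>, where \<open>(t - r) powr q\<close> dominates \<open>1 / (t - r)\<close>.\<close>
  define e where "e = min (d / 2) (min t 1)"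
  have e: "0 < e" "e < d" "e \<le> t" "e \<le> 1" using d t by (auto simp: e_def)
  define N where "N = (LINT r|lborel. indicator {0..t} r *\<^sub>R norm ((t - r) powr q *\<^sub>R X r))"
  \<comment> \<open>With this cut-off, \<open>c * (ln e - ln h)\<close> exceeds the value \<open>N\<close> of the integral by \<open>1\<close>.\<close>
  define h where "h = e * exp (- (N + 1) / c)"
  have N0: "0 \<le> N" unfolding N_def by (intro Bochner_Integration.integral_nonneg) auto
  have h: "0 < h" "h < e" using e c N0 by (auto simp: h_def divide_neg_pos)
  have ln_h: "c * ln h = c * ln e - (N + 1)"
    using e c by (simp add: h_def ln_mult field_simps)
  have ni: "set_integrable lborel {0..t} (\<lambda>r. norm ((t - r) powr q *\<^sub>R X r))"
    using int by (rule set_integrable_norm)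
  have "ennreal (N + 1) = ennreal (- (c * ln (t - (t - h))) - - (c * ln (t - (t - e))))"
    using e c by (simp add: ln_h field_simps)
  also have "\<dots> = (\<integral>\<^sup>+r. ennreal (c / (t - r)) * indicator {t - e..t - h} r \<partial>lborel)"
    using h c by (intro nn_integral_FTC_Icc[symmetric]) (auto intro!: derivative_eq_intros simp: field_simps)
  also have "\<dots> \<le> (\<integral>\<^sup>+r. ennreal (norm ((t - r) powr q *\<^sub>R X r)) * indicator {0..t} r \<partial>lborel)"
  proof (intro nn_integral_mono)
    fix r
    show "ennreal (c / (t - r)) * indicator {t - e..t - h} r
        \<le> ennreal (norm ((t - r) powr q *\<^sub>R X r)) * indicator {0..t} r"
    proof (cases "r \<in> {t - e..t - h}")
      case True
      then have r: "r \<in> {0..t}" "0 < t - r" "t - r \<le> 1" "dist r t < d"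
        using e h by (auto simp: dist_real_def)
      have "dist (X r) (X t) < c" using d(2) r by blast
      then have "c \<le> norm (X r)"
        using norm_triangle_ineq2[of "X t" "X r"] by (simp add: dist_norm norm_minus_commute c_def)
      moreover have "(t - r) powr (- 1) \<le> (t - r) powr q"
        using powr_mono'[OF q] r by simp
      ultimately have "(t - r) powr (- 1) * c \<le> (t - r) powr q * norm (X r)"
        using c by (intro mult_mono) auto
      then show ?thesis using True r by (auto simp: powr_minus_divide intro!: ennreal_leI)
    qed auto
  qed
  also have "\<dots> = ennreal N"
    unfolding N_def using ni[unfolded set_integrable_def]
    by (subst nn_integral_eq_integral[symmetric]) (auto intro!: nn_integral_cong simp: indicator_def)
  finally show False using N0 by simp
qed

text \<open>
  Divided by \<open>t powr a\<close>, the left-hand side tends to \<open>q\<close> in absolute value while the right-hand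
  side vanishes, so \<open>q = 0\<close>; what remains says that the constant \<open>p\<close> is bounded by a null
  function.
\<close>

lemma power_balance_zero:
  fixes p q K a \<alpha> l :: real
  assumes "0 < a" "a \<le> \<alpha>" "\<alpha> < l"
    and bd: "\<And>t. 0 < t \<Longrightarrow> \<bar>p - t powr a * q\<bar> \<le> K * (t powr (- l) + t powr (a - l) + t powr (\<alpha> - l))"
  shows "p = 0"
proof -
  have pw: "((\<lambda>t. t powr s) \<longlongrightarrow> 0) at_top" if "s < 0" for s :: real
    using that by (intro tendsto_neg_powr filterlim_ident)
  have "((\<lambda>t. K * (t powr (- l) + t powr (a - l) + t powr (\<alpha> - l))) \<longlongrightarrow> K * (0 + 0 + 0)) at_top"
    using assms by (intro tendsto_intros pw) auto
  then have lim: "((\<lambda>t. p - t powr a * q) \<longlongrightarrow> 0) at_top"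
    using bd by (intro Lim_null_comparison[where f = "\<lambda>t. p - t powr a * q"])
      (auto intro!: eventually_mono[OF eventually_gt_at_top[of 0]])
  have "((\<lambda>t. t powr (- a) * p - t powr (- a) * (p - t powr a * q)) \<longlongrightarrow> 0 * p - 0 * 0) at_top"
    using assms by (intro tendsto_intros pw lim) auto
  moreover have "eventually (\<lambda>t. t powr (- a) * p - t powr (- a) * (p - t powr a * q) = q) at_top"
    by (rule eventually_mono[OF eventually_gt_at_top[of 0]]) (simp add: algebra_simps powr_minus)
  ultimately have "((\<lambda>t::real. q) \<longlongrightarrow> 0) at_top"
    by (simp add: tendsto_cong)
  then have "q = 0" by (simp add: tendsto_const_iff)
  with lim show ?thesis by (simp add: tendsto_const_iff)
qed

section \<open>Orthogonality of It\^o integrals to initial variables\<close>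

lemma Int_stable_vimage:
  fixes X :: "'a \<Rightarrow> 'b::topological_space"
  shows "Int_stable {X -` S \<inter> space M | S. S \<in> sets borel}"
  unfolding Int_stable_def
proof safe
  fix S T :: "'b set" assume "S \<in> sets borel" "T \<in> sets borel"
  then show "\<exists>U. X -` S \<inter> space M \<inter> (X -` T \<inter> space M) = X -` U \<inter> space M \<and> U \<in> sets borel"
    by (intro exI[of _ "S \<inter> T"]) auto
qed

context brownian_basis
begin

lemma space_filtration: "0 \<le> t \<Longrightarrow> space (F t) = space M"
  using filtration_sub by (simp add: subalgebra_def)

lemma measurable_filtration: "0 \<le> t \<Longrightarrow> f \<in> measurable (F t) N \<Longrightarrow> f \<in> measurable M N"
  using filtration_sub by (rule measurable_from_subalg)

lemma measurable_filtration_mono: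
  "0 \<le> s \<Longrightarrow> s \<le> t \<Longrightarrow> f \<in> measurable (F s) N \<Longrightarrow> f \<in> measurable (F t) N"
  using filtration_mono by (rule measurable_from_subalg)

lemma increment_measurable:
  "0 \<le> s \<Longrightarrow> 0 \<le> t \<Longrightarrow> (\<lambda>\<omega>. W t \<omega> - W s \<omega>) \<in> borel_measurable M"
  using BM_adapted measurable_filtration by (intro borel_measurable_diff) blast+

lemma increment_indep_var:
  fixes Z :: "'w \<Rightarrow> real"
  assumes "0 \<le> s" "s < t" and Z: "Z \<in> borel_measurable (F s)"
  shows "indep_var borel Z borel (\<lambda>\<omega>. W t \<omega> - W s \<omega>)"
proof -
  let ?D = "\<lambda>\<omega>. W t \<omega> - W s \<omega>"
  let ?A = "{?D -` S \<inter> space M | S. S \<in> sets borel}"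
  let ?B = "{Z -` S \<inter> space M | S. S \<in> sets borel}"
  have sub: "?B \<subseteq> sets (F s)"
    using measurable_sets[OF Z] space_filtration[OF \<open>0 \<le> s\<close>] by auto
  have B: "Int_stable ?B"
    by (rule Int_stable_vimage)
  have A: "Int_stable ?A"
    by (rule Int_stable_vimage)
  have i: "indep_set ?B ?A"
    using BM_indep[OF assms(1,2)] sub unfolding indep_sets2_eq by blast
  have "indep_set (sigma_sets (space M) ?B) (sigma_sets (space M) ?A)"
    by (rule indep_set_sigma_sets[OF i B A])
  then show ?thesis
    unfolding indep_var_eq using increment_measurable assms measurable_filtration[OF assms(1) Z] by auto
qed

lemma increment_orthogonal:
  fixes Z :: "'w \<Rightarrow> real"
  assumes "0 \<le> s" "s \<le> t" and Z: "Z \<in> borel_measurable (F s)" and bd: "bounded (Z ` space M)"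
  shows "expectation (\<lambda>\<omega>. (W t \<omega> - W s \<omega>) * Z \<omega>) = 0"
    and "integrable M (\<lambda>\<omega>. W t \<omega> - W s \<omega>)"
proof -
  have ZM: "Z \<in> borel_measurable M" by (rule measurable_filtration[OF assms(1) Z])
  obtain C where C: "\<And>\<omega>. \<omega> \<in> space M \<Longrightarrow> norm (Z \<omega>) \<le> C"
    using bd unfolding bounded_iff by auto
  have iZ: "integrable M Z"
    by (rule integrable_const_bound[of _ C]) (use C ZM in auto)
  have "expectation (\<lambda>\<omega>. (W t \<omega> - W s \<omega>) * Z \<omega>) = 0 \<and> integrable M (\<lambda>\<omega>. W t \<omega> - W s \<omega>)"
  proof (cases "s = t")
    case False
    then have st: "s < t" using assms by simp
    note d = BM_normal[OF assms(1) st]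
    have pos: "0 < sqrt (t - s)" using st by simp
    have e0: "expectation (\<lambda>\<omega>. W t \<omega> - W s \<omega>) = 0"
      by (rule normal_distributed_expectation[OF pos d])
    have i: "integrable M (\<lambda>\<omega>. W t \<omega> - W s \<omega>)"
      using distributed_integrable[OF d, of "\<lambda>x. x"] integrable_normal_moment_nz_1[OF pos, of 0] by simp
    show ?thesis
      using indep_var_lebesgue_integral[OF increment_indep_var[OF assms(1) st Z] iZ i] e0 i
      by (simp add: mult.commute)
  qed simp
  then show "expectation (\<lambda>\<omega>. (W t \<omega> - W s \<omega>) * Z \<omega>) = 0"
    and "integrable M (\<lambda>\<omega>. W t \<omega> - W s \<omega>)" by auto
qed

text \<open>
  Each summand, paired with \<open>\<zeta>\<close>, is a Brownian increment over \<open>[\<tau> i, \<tau> (i + 1)]\<close> times a bounded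
  variable known at time \<open>\<tau> i\<close>, because \<open>\<zeta>\<close> is known at time \<open>0\<close> already.
\<close>

lemma simple_integral_orthogonal:
  fixes \<xi> :: "nat \<Rightarrow> 'w \<Rightarrow> 'b::euclidean_space"
  assumes simple: "simple_integrand M F T k \<tau> \<xi>"
    and \<zeta>: "\<zeta> \<in> borel_measurable (F 0)" and bd: "bounded (\<zeta> ` space M)"
  shows "integrable M (simple_integral W k \<tau> \<xi>)"
    and "expectation (\<lambda>\<omega>. simple_integral W k \<tau> \<xi> \<omega> \<bullet> \<zeta> \<omega>) = 0"
proof -
  have \<tau>0: "0 \<le> \<tau> i" if "i \<le> k" for i
    using that
  proof (induction i)
    case (Suc i)
    then have "\<tau> i \<le> \<tau> (Suc i)" "0 \<le> \<tau> i"
      using simple by (auto simp: simple_integrand_def)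
    then show ?case by simp
  qed (use simple in \<open>simp add: simple_integrand_def\<close>)
  have mono: "\<tau> i \<le> \<tau> (Suc i)" and \<xi>F: "\<xi> i \<in> borel_measurable (F (\<tau> i))"
    and \<xi>b: "bounded (\<xi> i ` space M)" if "i < k" for i
    using simple that by (auto simp: simple_integrand_def)
  obtain C where C: "\<And>\<omega>. \<omega> \<in> space M \<Longrightarrow> norm (\<zeta> \<omega>) \<le> C"
    using bd unfolding bounded_iff by auto
  let ?dW = "\<lambda>i \<omega>. W (\<tau> (Suc i)) \<omega> - W (\<tau> i) \<omega>"
  have summand: "integrable M (\<lambda>\<omega>. ?dW i \<omega> *\<^sub>R \<xi> i \<omega>)"
      "expectation (\<lambda>\<omega>. (?dW i \<omega> *\<^sub>R \<xi> i \<omega>) \<bullet> \<zeta> \<omega>) = 0" if i: "i < k" for i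
  proof -
    have t: "0 \<le> \<tau> i" using \<tau>0 i by simp
    obtain K where K: "\<And>\<omega>. \<omega> \<in> space M \<Longrightarrow> norm (\<xi> i \<omega>) \<le> K"
      using \<xi>b[OF i] unfolding bounded_iff by auto
    have Z: "(\<lambda>\<omega>. \<xi> i \<omega> \<bullet> \<zeta> \<omega>) \<in> borel_measurable (F (\<tau> i))"
      using \<xi>F[OF i] measurable_filtration_mono[OF order_refl t \<zeta>] by simp
    have Zb: "bounded ((\<lambda>\<omega>. \<xi> i \<omega> \<bullet> \<zeta> \<omega>) ` space M)"
      unfolding bounded_iff
    proof (intro exI ballI, safe)
      fix \<omega> assume w: "\<omega> \<in> space M"
      have "\<bar>\<xi> i \<omega> \<bullet> \<zeta> \<omega>\<bar> \<le> norm (\<xi> i \<omega>) * norm (\<zeta> \<omega>)"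
        by (rule Cauchy_Schwarz_ineq2)
      also have "\<dots> \<le> \<bar>K\<bar> * \<bar>C\<bar>"
        using K[OF w] C[OF w] by (intro mult_mono) auto
      finally show "norm (\<xi> i \<omega> \<bullet> \<zeta> \<omega>) \<le> \<bar>K\<bar> * \<bar>C\<bar>" by simp
    qed
    note o = increment_orthogonal[OF t mono[OF i] Z Zb]
    show "expectation (\<lambda>\<omega>. (?dW i \<omega> *\<^sub>R \<xi> i \<omega>) \<bullet> \<zeta> \<omega>) = 0"
      using o(1) by simp
    show "integrable M (\<lambda>\<omega>. ?dW i \<omega> *\<^sub>R \<xi> i \<omega>)"
    proof (rule Bochner_Integration.integrable_bound)
      show "integrable M (\<lambda>\<omega>. K * ?dW i \<omega>)" using o(2) by simp
      show "(\<lambda>\<omega>. ?dW i \<omega> *\<^sub>R \<xi> i \<omega>) \<in> borel_measurable M"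
        using o(2) measurable_filtration[OF t \<xi>F[OF i]] by simp
      show "AE \<omega> in M. norm (?dW i \<omega> *\<^sub>R \<xi> i \<omega>) \<le> norm (K * ?dW i \<omega>)"
      proof (rule AE_I2)
        fix \<omega> assume "\<omega> \<in> space M"
        then have "norm (\<xi> i \<omega>) \<le> \<bar>K\<bar>" using K by force
        then show "norm (?dW i \<omega> *\<^sub>R \<xi> i \<omega>) \<le> norm (K * ?dW i \<omega>)"
          by (simp add: abs_mult mult.commute mult_right_mono)
      qed
    qed
  qed
  have eq: "simple_integral W k \<tau> \<xi> = (\<lambda>\<omega>. \<Sum>i<k. ?dW i \<omega> *\<^sub>R \<xi> i \<omega>)"
    by (simp add: simple_integral_def fun_eq_iff)
  show "integrable M (simple_integral W k \<tau> \<xi>)"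
    unfolding eq using summand by (intro Bochner_Integration.integrable_sum) auto
  have "integrable M (\<lambda>\<omega>. (?dW i \<omega> *\<^sub>R \<xi> i \<omega>) \<bullet> \<zeta> \<omega>)" if "i < k" for i
    using measurable_filtration[OF order_refl \<zeta>] C
    by (intro integrable_inner_bounded[OF summand(1)[OF that]]) auto
  then show "expectation (\<lambda>\<omega>. simple_integral W k \<tau> \<xi> \<omega> \<bullet> \<zeta> \<omega>) = 0"
    using summand(2) by (simp add: eq inner_sum_left del: inner_scaleR_left)
qed

text \<open>
  It\^o integrals have conditional mean zero given the initial sigma-algebra. Orthogonality
  is inherited from the simple integrals, since mean-square convergence implies convergence
  of the pairings with a bounded \<open>\<zeta>\<close>.
\<close>

lemma ito_integral_orthogonal:
  fixes I :: "'w \<Rightarrow> 'b::euclidean_space"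
  assumes ito: "has_ito_integral M F W T f I"
    and \<zeta>: "\<zeta> \<in> borel_measurable (F 0)" and C: "\<And>\<omega>. norm (\<zeta> \<omega>) \<le> C"
  shows "integrable M I" and "expectation (\<lambda>\<omega>. I \<omega> \<bullet> \<zeta> \<omega>) = 0"
proof -
  obtain k \<tau> \<xi> where simple: "\<And>m. simple_integrand M F T (k m) (\<tau> m) (\<xi> m)"
    and lim: "(\<lambda>m. \<integral>\<^sup>+\<omega>. ennreal ((norm (I \<omega> - simple_integral W (k m) (\<tau> m) (\<xi> m) \<omega>))\<^sup>2) \<partial>M) \<longlonglongrightarrow> 0"
    and I[measurable]: "I \<in> borel_measurable M"
    using ito unfolding has_ito_integral_def by blast
  have bd: "bounded (\<zeta> ` space M)" using C by (auto simp: bounded_iff)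
  have \<zeta>M[measurable]: "\<zeta> \<in> borel_measurable M" by (rule measurable_filtration[OF order_refl \<zeta>])
  have approx: "integrable M I \<and> \<bar>expectation (\<lambda>\<omega>. I \<omega> \<bullet> \<zeta> \<omega>)\<bar> \<le> C * e" if e: "0 < e" for e
  proof -
    have "eventually (\<lambda>m. (\<integral>\<^sup>+\<omega>. ennreal ((norm (I \<omega> - simple_integral W (k m) (\<tau> m) (\<xi> m) \<omega>))\<^sup>2) \<partial>M) < ennreal (e\<^sup>2)) sequentially"
      using e by (intro order_tendstoD(2)[OF lim]) simp
    then obtain m where m: "(\<integral>\<^sup>+\<omega>. ennreal ((norm (I \<omega> - simple_integral W (k m) (\<tau> m) (\<xi> m) \<omega>))\<^sup>2) \<partial>M) < ennreal (e\<^sup>2)"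
      by (auto simp: eventually_sequentially)
    define S where "S = simple_integral W (k m) (\<tau> m) (\<xi> m)"
    note S = simple_integral_orthogonal[OF simple[of m] \<zeta> bd, folded S_def]
    have [measurable]: "S \<in> borel_measurable M" using S(1) by simp
    have sq: "integrable M (\<lambda>\<omega>. (norm (I \<omega> - S \<omega>))\<^sup>2)"
      using m unfolding S_def[symmetric] by (intro integrableI_bounded) (auto intro: less_trans)
    have IS: "integrable M (\<lambda>\<omega>. I \<omega> - S \<omega>)"
      by (rule L1_le_L2(1)[OF _ sq]) simp
    have "expectation (\<lambda>\<omega>. norm (I \<omega> - S \<omega>)) \<le> ms_norm M (\<lambda>\<omega>. I \<omega> - S \<omega>)"
      by (rule L1_le_L2(2)[OF _ sq]) simp
    also have "\<dots> \<le> e"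
    proof -
      have "ennreal (expectation (\<lambda>\<omega>. (norm (I \<omega> - S \<omega>))\<^sup>2)) < ennreal (e\<^sup>2)"
        using m sq unfolding S_def[symmetric] by (subst nn_integral_eq_integral[symmetric]) auto
      then have "expectation (\<lambda>\<omega>. (norm (I \<omega> - S \<omega>))\<^sup>2) \<le> e\<^sup>2"
        by (subst (asm) ennreal_less_iff) auto
      then show ?thesis unfolding ms_norm_def using e by (intro real_le_lsqrt) auto
    qed
    finally have small: "expectation (\<lambda>\<omega>. norm (I \<omega> - S \<omega>)) \<le> e" .
    have iI: "integrable M I" using Bochner_Integration.integrable_add[OF IS S(1)] by simp
    have "expectation (\<lambda>\<omega>. I \<omega> \<bullet> \<zeta> \<omega>) = expectation (\<lambda>\<omega>. (I \<omega> - S \<omega>) \<bullet> \<zeta> \<omega>) + expectation (\<lambda>\<omega>. S \<omega> \<bullet> \<zeta> \<omega>)"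
      using integrable_inner_bounded(1)[OF IS \<zeta>M C] integrable_inner_bounded(1)[OF S(1) \<zeta>M C]
      by (subst Bochner_Integration.integral_add[symmetric]) (auto simp: algebra_simps)
    also have "\<bar>\<dots>\<bar> \<le> C * expectation (\<lambda>\<omega>. norm (I \<omega> - S \<omega>))"
      using integrable_inner_bounded(2)[OF IS \<zeta>M C] S(2) by simp
    also have "\<dots> \<le> C * e"
      using small norm_ge_zero[of "\<zeta> undefined"] C[of undefined] by (intro mult_left_mono) linarith+
    finally show ?thesis using iI by simp
  qed
  show "integrable M I" using approx[of 1] by simp
  have "\<bar>expectation (\<lambda>\<omega>. I \<omega> \<bullet> \<zeta> \<omega>)\<bar> \<le> 0 + e" if e: "0 < e" for e
  proof -
    have C0: "0 \<le> C" using norm_ge_zero[of "\<zeta> undefined"] C[of undefined] by linarith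
    have "\<bar>expectation (\<lambda>\<omega>. I \<omega> \<bullet> \<zeta> \<omega>)\<bar> \<le> C * (e / (C + 1))"
      using approx[of "e / (C + 1)"] e C0 by simp
    also have "\<dots> \<le> e" using e C0 by (simp add: field_simps)
    finally show ?thesis by simp
  qed
  then show "expectation (\<lambda>\<omega>. I \<omega> \<bullet> \<zeta> \<omega>) = 0"
    using field_le_epsilon[of "\<bar>expectation (\<lambda>\<omega>. I \<omega> \<bullet> \<zeta> \<omega>)\<bar>" 0] by simp
qed

end

section \<open>Mild solutions paired with an initial variable\<close>

lemma H2_bounded_second_moment:
  fixes X :: "real \<Rightarrow> 'w \<Rightarrow> 'b::euclidean_space"
  assumes "X \<in> H2 M F T"
  obtains S where "0 \<le> S" "\<And>t. t \<in> {0..T} \<Longrightarrow> (\<integral>\<^sup>+\<omega>. ennreal ((norm (X t \<omega>))\<^sup>2) \<partial>M) \<le> ennreal S"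
proof -
  obtain S where S: "0 \<le> S" "(SUP t\<in>{0..T}. \<integral>\<^sup>+\<omega>. ennreal ((norm (X t \<omega>))\<^sup>2) \<partial>M) = ennreal S"
    using assms unfolding H2_def by (cases "SUP t\<in>{0..T}. \<integral>\<^sup>+\<omega>. ennreal ((norm (X t \<omega>))\<^sup>2) \<partial>M") auto
  show ?thesis
    using S(1) by (rule that) (auto simp flip: S(2) intro: SUP_upper)
qed

context brownian_basis
begin

lemma mild_solution_measurable:
  fixes X :: "real \<Rightarrow> 'w \<Rightarrow> real^'n"
  assumes "mild_solution_on M F W \<alpha> \<beta> A B b \<sigma> \<eta> T X" "t \<in> {0..T}"
  shows "X t \<in> borel_measurable M"
  using assms measurable_filtration[of t "X t" borel]
  by (auto simp: mild_solution_on_def H2_def measurable_adapted_def)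

lemma mild_solution_identity:
  fixes X :: "real \<Rightarrow> 'w \<Rightarrow> real^'n"
  assumes "mild_solution_on M F W \<alpha> \<beta> A B b \<sigma> \<eta> T X" "t \<in> {0..T}"
  obtains I where "has_ito_integral M F W t (\<lambda>r \<omega>. (t - r) powr (\<alpha> - 1) *\<^sub>R \<sigma> r (X r \<omega>)) I"
    "AE \<omega> in M.
       set_integrable lborel {0..t} (\<lambda>r. (t - r) powr (\<alpha> - \<beta> - 1) *\<^sub>R X r \<omega>) \<and>
       set_integrable lborel {0..t} (\<lambda>r. (t - r) powr (\<alpha> - 1) *\<^sub>R X r \<omega>) \<and>
       set_integrable lborel {0..t} (\<lambda>r. (t - r) powr (\<alpha> - 1) *\<^sub>R b r (X r \<omega>)) \<and>
       X t \<omega> = \<eta> \<omega> - (t powr (\<alpha> - \<beta>) / Gamma (\<alpha> - \<beta> + 1)) *\<^sub>R (A *v \<eta> \<omega>)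
         + (1 / Gamma (\<alpha> - \<beta>)) *\<^sub>R (A *v (LINT r:{0..t}|lborel. (t - r) powr (\<alpha> - \<beta> - 1) *\<^sub>R X r \<omega>))
         + (1 / Gamma \<alpha>) *\<^sub>R (B *v (LINT r:{0..t}|lborel. (t - r) powr (\<alpha> - 1) *\<^sub>R X r \<omega>))
         + (1 / Gamma \<alpha>) *\<^sub>R (LINT r:{0..t}|lborel. (t - r) powr (\<alpha> - 1) *\<^sub>R b r (X r \<omega>))
         + (1 / Gamma \<alpha>) *\<^sub>R I \<omega>"
proof -
  note * = assms(1)[unfolded mild_solution_on_def, THEN conjunct2, THEN conjunct2, THEN conjunct2,
      THEN bspec, OF assms(2)]
  show thesis by (rule exE[OF *], erule conjE, rule that)
qed

text \<open>
  When \<open>\<alpha> \<le> \<beta>\<close> the integrability built into a mild solution forces \<open>X t = 0\<close> almost surely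
  for each positive \<open>t\<close> up to the horizon. Only countably many exceptional null sets may be combined, which is why
  continuity at \<open>0\<close> is used along \<open>t = 1 / (n + 1)\<close>.
\<close>

lemma mild_solution_zero_of_singular_kernel:
  fixes X :: "real \<Rightarrow> 'w \<Rightarrow> real^'n"
  assumes sol: "mild_solution_on M F W \<alpha> \<beta> A B b \<sigma> \<eta> 1 X" and "\<alpha> \<le> \<beta>"
  shows "AE \<omega> in M. X 0 \<omega> = 0"
proof -
  have "AE \<omega> in M. set_integrable lborel {0..t} (\<lambda>r. (t - r) powr (\<alpha> - \<beta> - 1) *\<^sub>R X r \<omega>)"
    if "t \<in> {0..1}" for t
    by (rule mild_solution_identity[OF sol that]) (erule eventually_mono, blast)
  then have "AE \<omega> in M. \<forall>n. set_integrable lborel {0..1 / real (Suc n)}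
      (\<lambda>r. (1 / real (Suc n) - r) powr (\<alpha> - \<beta> - 1) *\<^sub>R X r \<omega>)"
    by (subst AE_all_countable) simp
  moreover have "AE \<omega> in M. continuous_on {0..1} (\<lambda>t. X t \<omega>)"
    using sol by (simp add: mild_solution_on_def)
  ultimately show ?thesis
  proof eventually_elim
    case (elim \<omega>)
    have zero: "X (1 / real (Suc n)) \<omega> = 0" for n
    proof (rule singular_kernel_forces_zero[where X = "\<lambda>t. X t \<omega>" and q = "\<alpha> - \<beta> - 1"])
      have "1 / real (Suc n) \<le> 1" by simp
      then show "continuous_on {0..1 / real (Suc n)} (\<lambda>t. X t \<omega>)"
        by (intro continuous_on_subset[OF elim(2)]) (simp only: atLeastatMost_subset_iff, simp)
    qed (use elim(1) \<open>\<alpha> \<le> \<beta>\<close> in auto)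
    have "(\<lambda>n. X (1 / real (Suc n)) \<omega>) \<longlonglongrightarrow> X 0 \<omega>"
      by (rule continuous_on_tendsto_compose[OF elim(2) LIMSEQ_Suc[OF lim_1_over_n]]) auto
    then show ?case using zero by (simp add: LIMSEQ_const_iff)
  qed
qed

text \<open>
  At \<open>t = 0\<close> all time integrals run over a single point, and \<open>0 powr (\<alpha> - \<beta>)\<close> is \<open>0\<close>. The
  It\^o integral over \<open>[0,0]\<close> disappears after pairing with \<open>\<zeta>\<close>.
\<close>

lemma projected_initial_value:
  fixes X :: "real \<Rightarrow> 'w \<Rightarrow> real^'n"
  assumes sol: "mild_solution_on M F W \<alpha> \<beta> A B b \<sigma> \<eta> T X" and "0 \<le> T"
    and \<zeta>: "\<zeta> \<in> borel_measurable (F 0)" "\<And>\<omega>. norm (\<zeta> \<omega>) \<le> C"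
    and i: "integrable M \<eta>"
  shows "expectation (\<lambda>\<omega>. X 0 \<omega> \<bullet> \<zeta> \<omega>) = expectation (\<lambda>\<omega>. \<eta> \<omega> \<bullet> \<zeta> \<omega>)"
proof -
  have null: "(LINT r:{0..0}|lborel. f r) = 0" for f :: "real \<Rightarrow> real^'n"
    unfolding set_lebesgue_integral_def
    by (rule integral_eq_zero_AE, rule AE_mp[OF AE_lborel_singleton[of 0]], rule AE_I2) simp
  have "0 \<in> {0..T}" using \<open>0 \<le> T\<close> by simp
  then obtain I where ito: "has_ito_integral M F W 0 (\<lambda>r \<omega>. (0 - r) powr (\<alpha> - 1) *\<^sub>R \<sigma> r (X r \<omega>)) I"
    and "AE \<omega> in M. X 0 \<omega> = \<eta> \<omega> - (0 powr (\<alpha> - \<beta>) / Gamma (\<alpha> - \<beta> + 1)) *\<^sub>R (A *v \<eta> \<omega>)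
      + (1 / Gamma (\<alpha> - \<beta>)) *\<^sub>R (A *v 0) + (1 / Gamma \<alpha>) *\<^sub>R (B *v 0)
      + (1 / Gamma \<alpha>) *\<^sub>R 0 + (1 / Gamma \<alpha>) *\<^sub>R I \<omega>"
    by (rule mild_solution_identity[OF sol], unfold null)
      (rule that, assumption, erule eventually_mono, elim conjE)
  then have eq: "AE \<omega> in M. X 0 \<omega> = \<eta> \<omega> + (1 / Gamma \<alpha>) *\<^sub>R I \<omega>"
    by (simp add: matrix_vector_mult_0_right)
  note o = ito_integral_orthogonal[OF ito \<zeta>]
  have \<zeta>M[measurable]: "\<zeta> \<in> borel_measurable M" by (rule measurable_filtration[OF order_refl \<zeta>(1)])
  have [measurable]: "X 0 \<in> borel_measurable M" "I \<in> borel_measurable M" "\<eta> \<in> borel_measurable M"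
    using mild_solution_measurable[OF sol, of 0] \<open>0 \<le> T\<close> o(1) i by auto
  have "expectation (\<lambda>\<omega>. X 0 \<omega> \<bullet> \<zeta> \<omega>) = expectation (\<lambda>\<omega>. \<eta> \<omega> \<bullet> \<zeta> \<omega> + (1 / Gamma \<alpha>) * (I \<omega> \<bullet> \<zeta> \<omega>))"
    using eq by (intro integral_cong_AE) (auto simp: inner_add_left)
  also have "\<dots> = expectation (\<lambda>\<omega>. \<eta> \<omega> \<bullet> \<zeta> \<omega>)"
    using integrable_inner_bounded(1)[OF i \<zeta>M \<zeta>(2)] integrable_inner_bounded(1)[OF o(1) \<zeta>M \<zeta>(2)] o(2)
    by simp
  finally show ?thesis .
qed

text \<open>
  A finite upper limit controls the difference of the solutions only from some time \<open>T\<close> on.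
  On \<open>(0,T]\<close> the second moments are bounded, and a constant is at most a multiple of
  \<open>r powr (- l)\<close> there, so one power bound holds on the whole half-line. Lowering the exponent
  from \<open>\<mu>\<close> to \<open>l\<close> is harmless for large times and leaves room for \<open>l < 1\<close>, which makes the
  bound integrable at \<open>0\<close>.
\<close>

lemma first_moment_power_bound:
  fixes X Y :: "real \<Rightarrow> 'w \<Rightarrow> 'b::euclidean_space"
  assumes X: "\<And>T. 0 < T \<Longrightarrow> X \<in> H2 M F T" and Y: "\<And>T. 0 < T \<Longrightarrow> Y \<in> H2 M F T"
    and l: "0 < l" "l \<le> \<mu>"
    and fin: "Limsup at_top (\<lambda>t. ereal (t powr \<mu> * ms_norm M (\<lambda>\<omega>. X t \<omega> - Y t \<omega>))) \<noteq> \<infinity>"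
  obtains C where "0 \<le> C"
    "\<And>r. 0 < r \<Longrightarrow> (\<integral>\<^sup>+\<omega>. ennreal (norm (X r \<omega> - Y r \<omega>)) \<partial>M) \<le> ennreal (C * r powr (- l))"
proof -
  obtain K where K: "Limsup at_top (\<lambda>t. ereal (t powr \<mu> * ms_norm M (\<lambda>\<omega>. X t \<omega> - Y t \<omega>))) < ereal K"
    using fin ereal_dense2[of _ \<infinity>] unfolding ereal_infty_less(1)[symmetric] by blast
  obtain T0 where T0: "\<And>t. T0 \<le> t \<Longrightarrow> t powr \<mu> * ms_norm M (\<lambda>\<omega>. X t \<omega> - Y t \<omega>) < K"
    using Limsup_lessD[OF K] by (auto simp: eventually_at_top_linorder)
  define T where "T = max T0 1"
  have T: "1 \<le> T" "T0 \<le> T" by (auto simp: T_def)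
  have m: "X r \<in> borel_measurable M" "Y r \<in> borel_measurable M" if "0 < r" for r
    using X[OF that] Y[OF that] that measurable_filtration[of r _ borel]
    by (auto simp: H2_def measurable_adapted_def)
  obtain S where S: "0 \<le> S" "\<And>t. t \<in> {0..T} \<Longrightarrow> (\<integral>\<^sup>+\<omega>. ennreal ((norm (X t \<omega>))\<^sup>2) \<partial>M) \<le> ennreal S"
    using H2_bounded_second_moment[OF X[of T]] T by auto
  obtain S' where S': "0 \<le> S'" "\<And>t. t \<in> {0..T} \<Longrightarrow> (\<integral>\<^sup>+\<omega>. ennreal ((norm (Y t \<omega>))\<^sup>2) \<partial>M) \<le> ennreal S'"
    using H2_bounded_second_moment[OF Y[of T]] T by auto
  have K0: "0 \<le> K"
  proof -
    have "0 \<le> T powr \<mu> * ms_norm M (\<lambda>\<omega>. X T \<omega> - Y T \<omega>)"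
      by (simp add: ms_norm_def)
    with T0[OF T(2)] show ?thesis by linarith
  qed
  define C where "C = (1 + S + S') * T powr l + K"
  have C0: "0 \<le> C" using S(1) S'(1) K0 by (simp add: C_def)
  show thesis
  proof (rule that[OF C0])
    fix r :: real assume r: "0 < r"
    note [measurable] = m[OF r]
    show "(\<integral>\<^sup>+\<omega>. ennreal (norm (X r \<omega> - Y r \<omega>)) \<partial>M) \<le> ennreal (C * r powr (- l))"
    proof (cases "r \<le> T")
      case True
      have "(\<integral>\<^sup>+\<omega>. ennreal (norm (X r \<omega> - Y r \<omega>)) \<partial>M)
          \<le> (\<integral>\<^sup>+\<omega>. 1 + ennreal ((norm (X r \<omega>))\<^sup>2) + ennreal ((norm (Y r \<omega>))\<^sup>2) \<partial>M)"
      proof (intro nn_integral_mono)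
        fix \<omega>
        have "x \<le> 1 / 2 + x\<^sup>2" for x :: real
          using zero_le_power2[of "x - 1 / 2"] by (simp add: power2_eq_square algebra_simps)
        from this[of "norm (X r \<omega>)"] this[of "norm (Y r \<omega>)"]
        have "norm (X r \<omega> - Y r \<omega>) \<le> 1 + (norm (X r \<omega>))\<^sup>2 + (norm (Y r \<omega>))\<^sup>2"
          using norm_triangle_ineq4[of "X r \<omega>" "Y r \<omega>"] by linarith
        then have "ennreal (norm (X r \<omega> - Y r \<omega>)) \<le> ennreal (1 + (norm (X r \<omega>))\<^sup>2 + (norm (Y r \<omega>))\<^sup>2)"
          by (rule ennreal_leI)
        then show "ennreal (norm (X r \<omega> - Y r \<omega>)) \<le> 1 + ennreal ((norm (X r \<omega>))\<^sup>2) + ennreal ((norm (Y r \<omega>))\<^sup>2)"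
          by (simp add: ennreal_plus)
      qed
      also have "\<dots> = 1 + (\<integral>\<^sup>+\<omega>. ennreal ((norm (X r \<omega>))\<^sup>2) \<partial>M) + (\<integral>\<^sup>+\<omega>. ennreal ((norm (Y r \<omega>))\<^sup>2) \<partial>M)"
        by (simp add: nn_integral_add emeasure_space_1)
      also have "\<dots> \<le> 1 + ennreal S + ennreal S'"
        using r True by (intro add_mono S S' order_refl) auto
      also have "\<dots> = ennreal (1 + S + S')" using S(1) S'(1) by (simp add: ennreal_plus)
      also have "\<dots> \<le> ennreal (C * r powr (- l))"
      proof (rule ennreal_leI)
        have "r powr l \<le> T powr l" using r True l by (intro powr_mono2) auto
        then have "(1 + S + S') * 1 \<le> (1 + S + S') * (T powr l * r powr (- l))"
          using r S(1) S'(1) by (intro mult_left_mono) (auto simp: powr_minus field_simps)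
        also have "\<dots> \<le> C * r powr (- l)"
          using K0 by (simp add: C_def algebra_simps)
        finally show "1 + S + S' \<le> C * r powr (- l)" by simp
      qed
      finally show ?thesis .
    next
      case False
      then have r1: "T0 \<le> r" "1 \<le> r" using T by auto
      obtain Sx where Sx: "(\<integral>\<^sup>+\<omega>. ennreal ((norm (X r \<omega>))\<^sup>2) \<partial>M) \<le> ennreal Sx"
        using H2_bounded_second_moment[OF X[OF r]] r by (metis atLeastAtMost_iff less_eq_real_def)
      obtain Sy where Sy: "(\<integral>\<^sup>+\<omega>. ennreal ((norm (Y r \<omega>))\<^sup>2) \<partial>M) \<le> ennreal Sy"
        using H2_bounded_second_moment[OF Y[OF r]] r by (metis atLeastAtMost_iff less_eq_real_def)
      note sq = difference_square_integrable[OF m[OF r] Sx Sy]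
      have i: "integrable M (\<lambda>\<omega>. X r \<omega> - Y r \<omega>)" by (rule L1_le_L2(1)[OF _ sq]) simp
      have "expectation (\<lambda>\<omega>. norm (X r \<omega> - Y r \<omega>)) \<le> ms_norm M (\<lambda>\<omega>. X r \<omega> - Y r \<omega>)"
        by (rule L1_le_L2(2)[OF _ sq]) simp
      also have "\<dots> \<le> K * r powr (- \<mu>)"
        using T0[OF r1(1)] r by (simp add: powr_minus field_simps)
      also have "\<dots> \<le> C * r powr (- l)"
        using K0 r1 l S(1) S'(1) by (intro mult_mono powr_mono) (auto simp: C_def)
      finally have "ennreal (expectation (\<lambda>\<omega>. norm (X r \<omega> - Y r \<omega>))) \<le> ennreal (C * r powr (- l))"
        by (rule ennreal_leI)
      then show ?thesis using i by (subst nn_integral_eq_integral) auto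
    qed
  qed
qed

text \<open>
  The analytic core. In the difference of the two mild equations at time \<open>t\<close>, everything
  that involves only the initial values is known at time \<open>0\<close>. Pairing with an initial
  variable \<open>\<zeta>\<close> removes the two It\^o integrals; the remaining terms are \<open>X t - Y t\<close> and
  three Abel convolutions of differences, which inherit power bounds from the
  one assumed for the first moment of \<open>X - Y\<close>.
\<close>

lemma projected_difference_bound:
  fixes X Y :: "real \<Rightarrow> 'w \<Rightarrow> real^'n"
  assumes solX: "mild_solution_on M F W \<alpha> \<beta> A B b \<sigma> \<eta> T X"
    and solY: "mild_solution_on M F W \<alpha> \<beta> A B b \<sigma> \<gamma> T Y"
    and \<eta>: "\<eta> \<in> Xi M F 0" and \<gamma>: "\<gamma> \<in> Xi M F 0"
    and t: "0 < t" "t \<le> T" and l: "l < 1" and C: "0 \<le> C"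
    and \<alpha>: "0 < \<alpha>" "\<beta> < \<alpha>"
    and L: "0 \<le> L" "\<And>r x y. 0 \<le> r \<Longrightarrow> norm (b r x - b r y) \<le> L * norm (x - y)"
    and bd: "\<And>r. 0 < r \<Longrightarrow> r \<le> t \<Longrightarrow> (\<integral>\<^sup>+\<omega>. ennreal (norm (X r \<omega> - Y r \<omega>)) \<partial>M) \<le> ennreal (C * r powr (- l))"
    and \<zeta>: "\<zeta> \<in> borel_measurable (F 0)" "\<And>\<omega>. norm (\<zeta> \<omega>) \<le> 1"
  shows "\<bar>expectation (\<lambda>\<omega>. (\<eta> \<omega> - \<gamma> \<omega>) \<bullet> \<zeta> \<omega>)
      - t powr (\<alpha> - \<beta>) / Gamma (\<alpha> - \<beta> + 1) * expectation (\<lambda>\<omega>. (A *v (\<eta> \<omega> - \<gamma> \<omega>)) \<bullet> \<zeta> \<omega>)\<bar>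
    \<le> C * t powr (- l)
      + onorm ((*v) A) / Gamma (\<alpha> - \<beta>) * (C * Beta (1 - l) (\<alpha> - \<beta>) * t powr (\<alpha> - \<beta> - l))
      + (onorm ((*v) B) + L) / Gamma \<alpha> * (C * Beta (1 - l) \<alpha> * t powr (\<alpha> - l))"
proof -
  let ?D = "\<lambda>r \<omega>. X r \<omega> - Y r \<omega>"
  have tT: "t \<in> {0..T}" using t by simp
  define a where "a = \<alpha> - \<beta>"
  have a: "0 < a" using \<alpha> by (simp add: a_def)
  define c where "c = t powr a / Gamma (a + 1)"
  define \<delta> where "\<delta> \<omega> = \<eta> \<omega> - \<gamma> \<omega>" for \<omega>
  define G where "G p \<omega> = (\<integral>\<^sup>+r\<in>{0..t}. ennreal ((t - r) powr (p - 1) * norm (?D r \<omega>)) \<partial>lborel)" for p \<omega>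
  define K1 where "K1 = onorm ((*v) A) / Gamma a"
  define K2 where "K2 = (onorm ((*v) B) + L) / Gamma \<alpha>"
  have oA: "norm (A *v x) \<le> onorm ((*v) A) * norm x" and oB: "norm (B *v x) \<le> onorm ((*v) B) * norm x" for x
    by (rule onorm[OF matrix_vector_mul_bounded_linear])+
  have oA0: "0 \<le> onorm ((*v) A)" and oB0: "0 \<le> onorm ((*v) B)"
    by (rule onorm_pos_le[OF matrix_vector_mul_bounded_linear])+
  have K0: "0 \<le> K1" "0 \<le> K2"
    using a \<alpha> L(1) oA0 oB0 by (auto simp: K1_def K2_def)
  obtain IX where itoX: "has_ito_integral M F W t (\<lambda>r \<omega>. (t - r) powr (\<alpha> - 1) *\<^sub>R \<sigma> r (X r \<omega>)) IX"
    and eqX: "AE \<omega> in M.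
           set_integrable lborel {0..t} (\<lambda>r. (t - r) powr (a - 1) *\<^sub>R X r \<omega>) \<and>
           set_integrable lborel {0..t} (\<lambda>r. (t - r) powr (\<alpha> - 1) *\<^sub>R X r \<omega>) \<and>
           set_integrable lborel {0..t} (\<lambda>r. (t - r) powr (\<alpha> - 1) *\<^sub>R b r (X r \<omega>)) \<and>
           X t \<omega> = \<eta> \<omega> - c *\<^sub>R (A *v \<eta> \<omega>)
             + (1 / Gamma a) *\<^sub>R (A *v (LINT r:{0..t}|lborel. (t - r) powr (a - 1) *\<^sub>R X r \<omega>))
             + (1 / Gamma \<alpha>) *\<^sub>R (B *v (LINT r:{0..t}|lborel. (t - r) powr (\<alpha> - 1) *\<^sub>R X r \<omega>))
             + (1 / Gamma \<alpha>) *\<^sub>R (LINT r:{0..t}|lborel. (t - r) powr (\<alpha> - 1) *\<^sub>R b r (X r \<omega>))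
             + (1 / Gamma \<alpha>) *\<^sub>R IX \<omega>"
    unfolding a_def c_def by (rule mild_solution_identity[OF solX tT])
  obtain IY where itoY: "has_ito_integral M F W t (\<lambda>r \<omega>. (t - r) powr (\<alpha> - 1) *\<^sub>R \<sigma> r (Y r \<omega>)) IY"
    and eqY: "AE \<omega> in M.
           set_integrable lborel {0..t} (\<lambda>r. (t - r) powr (a - 1) *\<^sub>R Y r \<omega>) \<and>
           set_integrable lborel {0..t} (\<lambda>r. (t - r) powr (\<alpha> - 1) *\<^sub>R Y r \<omega>) \<and>
           set_integrable lborel {0..t} (\<lambda>r. (t - r) powr (\<alpha> - 1) *\<^sub>R b r (Y r \<omega>)) \<and>
           Y t \<omega> = \<gamma> \<omega> - c *\<^sub>R (A *v \<gamma> \<omega>)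
             + (1 / Gamma a) *\<^sub>R (A *v (LINT r:{0..t}|lborel. (t - r) powr (a - 1) *\<^sub>R Y r \<omega>))
             + (1 / Gamma \<alpha>) *\<^sub>R (B *v (LINT r:{0..t}|lborel. (t - r) powr (\<alpha> - 1) *\<^sub>R Y r \<omega>))
             + (1 / Gamma \<alpha>) *\<^sub>R (LINT r:{0..t}|lborel. (t - r) powr (\<alpha> - 1) *\<^sub>R b r (Y r \<omega>))
             + (1 / Gamma \<alpha>) *\<^sub>R IY \<omega>"
    unfolding a_def c_def by (rule mild_solution_identity[OF solY tT])
  \<comment> \<open>The pathwise remainder: by the mild equations it equals \<open>X t - Y t\<close> minus the convolutions, which bounds it;
    in the present form its pairing with \<open>\<zeta>\<close> is computed.\<close>
  define R where "R \<omega> = \<delta> \<omega> - c *\<^sub>R (A *v \<delta> \<omega>) + (1 / Gamma \<alpha>) *\<^sub>R (IX \<omega> - IY \<omega>)" for \<omega>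
  have pathwise: "AE \<omega> in M. ennreal (norm (R \<omega>))
      \<le> ennreal (norm (?D t \<omega>)) + (ennreal K1 * G a \<omega> + ennreal K2 * G \<alpha> \<omega>)"
    using eqX eqY
  proof eventually_elim
    case (elim \<omega>)
    let ?ia = "\<lambda>Z. LINT r:{0..t}|lborel. (t - r) powr (a - 1) *\<^sub>R Z r \<omega>"
    let ?i = "\<lambda>Z. LINT r:{0..t}|lborel. (t - r) powr (\<alpha> - 1) *\<^sub>R Z r \<omega>"
    let ?bX = "\<lambda>r \<omega>. b r (X r \<omega>)" and ?bY = "\<lambda>r \<omega>. b r (Y r \<omega>)"
    have G: "(\<integral>\<^sup>+r\<in>{0..t}. ennreal (norm ((t - r) powr (p - 1) *\<^sub>R X r \<omega> - (t - r) powr (p - 1) *\<^sub>R Y r \<omega>)) \<partial>lborel) = G p \<omega>" for p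
      by (simp add: G_def flip: scaleR_diff_right)
    have d1: "ennreal (norm (?ia X - ?ia Y)) \<le> G a \<omega>"
      using set_integral_diff_bound[of "{0..t}" "\<lambda>r. (t - r) powr (a - 1) *\<^sub>R X r \<omega>" "\<lambda>r. (t - r) powr (a - 1) *\<^sub>R Y r \<omega>"
          "\<lambda>r. (t - r) powr (a - 1) *\<^sub>R X r \<omega>" "\<lambda>r. (t - r) powr (a - 1) *\<^sub>R Y r \<omega>" 1] elim
      unfolding G by simp
    have d2: "ennreal (norm (?i X - ?i Y)) \<le> G \<alpha> \<omega>"
      using set_integral_diff_bound[of "{0..t}" "\<lambda>r. (t - r) powr (\<alpha> - 1) *\<^sub>R X r \<omega>" "\<lambda>r. (t - r) powr (\<alpha> - 1) *\<^sub>R Y r \<omega>"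
          "\<lambda>r. (t - r) powr (\<alpha> - 1) *\<^sub>R X r \<omega>" "\<lambda>r. (t - r) powr (\<alpha> - 1) *\<^sub>R Y r \<omega>" 1] elim
      unfolding G by simp
    have "norm ((t - r) powr (\<alpha> - 1) *\<^sub>R b r (X r \<omega>) - (t - r) powr (\<alpha> - 1) *\<^sub>R b r (Y r \<omega>))
        \<le> L * norm ((t - r) powr (\<alpha> - 1) *\<^sub>R X r \<omega> - (t - r) powr (\<alpha> - 1) *\<^sub>R Y r \<omega>)" if "r \<in> {0..t}" for r
    proof -
      have "(t - r) powr (\<alpha> - 1) * norm (b r (X r \<omega>) - b r (Y r \<omega>))
          \<le> (t - r) powr (\<alpha> - 1) * (L * norm (X r \<omega> - Y r \<omega>))"
        using that by (intro mult_left_mono L) auto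
      then show ?thesis by (simp add: mult_ac flip: scaleR_diff_right)
    qed
    then have d3: "ennreal (norm (?i ?bX - ?i ?bY)) \<le> ennreal L * G \<alpha> \<omega>"
      using set_integral_diff_bound[of "{0..t}" "\<lambda>r. (t - r) powr (\<alpha> - 1) *\<^sub>R b r (X r \<omega>)" "\<lambda>r. (t - r) powr (\<alpha> - 1) *\<^sub>R b r (Y r \<omega>)"
          "\<lambda>r. (t - r) powr (\<alpha> - 1) *\<^sub>R X r \<omega>" "\<lambda>r. (t - r) powr (\<alpha> - 1) *\<^sub>R Y r \<omega>" L] elim L(1)
      unfolding G by simp
    have eR: "R \<omega> = ?D t \<omega> - ((1 / Gamma a) *\<^sub>R (A *v (?ia X - ?ia Y))
        + (1 / Gamma \<alpha>) *\<^sub>R (B *v (?i X - ?i Y)) + (1 / Gamma \<alpha>) *\<^sub>R (?i ?bX - ?i ?bY))"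
      unfolding R_def \<delta>_def elim(1)[THEN conjunct2, THEN conjunct2, THEN conjunct2]
        elim(2)[THEN conjunct2, THEN conjunct2, THEN conjunct2]
      by (simp add: matrix_vector_mult_diff_distrib scaleR_diff_right algebra_simps)
    have "norm (R \<omega>) \<le> norm (?D t \<omega>) + (1 / Gamma a * (onorm ((*v) A) * norm (?ia X - ?ia Y))
        + 1 / Gamma \<alpha> * (onorm ((*v) B) * norm (?i X - ?i Y)) + 1 / Gamma \<alpha> * norm (?i ?bX - ?i ?bY))"
    proof -
      have ga: "norm ((1 / Gamma a) *\<^sub>R v) = 1 / Gamma a * norm v" for v :: "real^'n"
        using Gamma_real_pos[OF a] by simp
      have g\<alpha>: "norm ((1 / Gamma \<alpha>) *\<^sub>R v) = 1 / Gamma \<alpha> * norm v" for v :: "real^'n"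
        using Gamma_real_pos[OF \<alpha>(1)] by simp
      have tri: "norm (x - (u + v + w)) \<le> norm x + (norm u + norm v + norm w)" for x u v w :: "real^'n"
        using norm_triangle_ineq4[of x "u + v + w"] norm_triangle_ineq[of "u + v" w] norm_triangle_ineq[of u v]
        by linarith
      show ?thesis
        unfolding eR
        by (rule order_trans[OF tri], unfold ga g\<alpha>, intro add_mono mult_left_mono oA oB order_refl)
          (use Gamma_real_pos[OF a] Gamma_real_pos[OF \<alpha>(1)] in auto)
    qed
    also have "\<dots> = norm (?D t \<omega>) + (K1 * norm (?ia X - ?ia Y)
        + (onorm ((*v) B) / Gamma \<alpha> * norm (?i X - ?i Y) + 1 / Gamma \<alpha> * norm (?i ?bX - ?i ?bY)))"
      by (simp add: K1_def)
    finally have "ennreal (norm (R \<omega>)) \<le> ennreal (norm (?D t \<omega>)) + (ennreal K1 * ennreal (norm (?ia X - ?ia Y))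
        + (ennreal (onorm ((*v) B) / Gamma \<alpha>) * ennreal (norm (?i X - ?i Y))
          + ennreal (1 / Gamma \<alpha>) * ennreal (norm (?i ?bX - ?i ?bY))))"
      using K0 oB0 Gamma_real_pos[OF \<alpha>(1)]
      by (simp add: ennreal_mult'[symmetric] ennreal_plus[symmetric] ennreal_leI del: ennreal_plus)
    also have "\<dots> \<le> ennreal (norm (?D t \<omega>)) + (ennreal K1 * G a \<omega>
        + (ennreal (onorm ((*v) B) / Gamma \<alpha>) * G \<alpha> \<omega> + ennreal (1 / Gamma \<alpha>) * (ennreal L * G \<alpha> \<omega>)))"
      by (intro add_mono mult_left_mono d1 d2 d3 order_refl) simp_all
    also have "ennreal (onorm ((*v) B) / Gamma \<alpha>) * G \<alpha> \<omega> + ennreal (1 / Gamma \<alpha>) * (ennreal L * G \<alpha> \<omega>)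
        = ennreal K2 * G \<alpha> \<omega>"
    proof -
      have "ennreal K2 = ennreal (onorm ((*v) B) / Gamma \<alpha>) + ennreal (1 / Gamma \<alpha>) * ennreal L"
        using oB0 L(1) Gamma_real_pos[OF \<alpha>(1)]
        by (simp add: K2_def ennreal_mult'[symmetric] ennreal_plus[symmetric] add_divide_distrib del: ennreal_plus)
      then show ?thesis by (simp add: distrib_right mult.assoc)
    qed
    finally show ?case .
  qed
  have [measurable]: "X t \<in> borel_measurable M" "Y t \<in> borel_measurable M"
    using mild_solution_measurable[OF solX tT] mild_solution_measurable[OF solY tT] by auto
  have joint: "(\<lambda>(r, \<omega>). ?D r \<omega>) \<in> borel_measurable (restrict_space borel {0..t} \<Otimes>\<^sub>M M)"
  proof -
    have "(\<lambda>(r, \<omega>). ?D r \<omega>) \<in> borel_measurable (restrict_space borel {0..T} \<Otimes>\<^sub>M M)"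
      using solX solY unfolding mild_solution_on_def H2_def measurable_adapted_def split_beta'
      by (auto intro!: borel_measurable_diff)
    moreover have "(\<lambda>z. (fst z, snd z)) \<in> (restrict_space borel {0..t} \<Otimes>\<^sub>M M) \<rightarrow>\<^sub>M (restrict_space borel {0..T} \<Otimes>\<^sub>M M)"
    proof (rule measurable_Pair)
      have "(\<lambda>r. r) \<in> restrict_space borel {0..t} \<rightarrow>\<^sub>M restrict_space borel {0..T}"
        using t by (intro measurable_restrict_space3) auto
      then show "fst \<in> (restrict_space borel {0..t} \<Otimes>\<^sub>M M) \<rightarrow>\<^sub>M restrict_space borel {0..T}"
        by (rule measurable_compose[OF measurable_fst])
    qed simp
    ultimately show ?thesis
      using measurable_compose by fastforce
  qed
  note conv = abel_convolution_L1[OF joint _ l t(1) C bd]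
  have Gm: "G p \<in> borel_measurable M" if "0 < p" for p
    unfolding G_def using conv(1)[OF that] by simp
  have Gi: "(\<integral>\<^sup>+\<omega>. G p \<omega> \<partial>M) \<le> ennreal (C * Beta (1 - l) p * t powr (p - l))" if "0 < p" for p
    unfolding G_def using conv(2)[OF that] by simp
  have B0: "0 \<le> Beta (1 - l) p" if "0 < p" for p using that l by (simp add: Beta_def)
  define Q where "Q = C * t powr (- l)
      + (K1 * (C * Beta (1 - l) a * t powr (a - l)) + K2 * (C * Beta (1 - l) \<alpha> * t powr (\<alpha> - l)))"
  have Q0: "0 \<le> Q" using C K0 B0[OF a] B0[OF \<alpha>(1)] by (simp add: Q_def)
  have \<eta>F: "\<eta> \<in> borel_measurable (F 0)" "\<gamma> \<in> borel_measurable (F 0)"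
    using \<eta> \<gamma> by (auto simp: Xi_def)
  have i\<eta>: "integrable M \<eta>" "integrable M \<gamma>"
    using L1_le_L2(1)[of \<eta>] L1_le_L2(1)[of \<gamma>] \<eta> \<gamma> \<eta>F[THEN measurable_filtration[OF order_refl]]
    by (auto simp: Xi_def)
  have i\<delta>: "integrable M \<delta>" unfolding \<delta>_def[abs_def] using i\<eta> by simp
  have iA: "integrable M (\<lambda>\<omega>. A *v \<delta> \<omega>)"
    by (rule integrable_bounded_linear[OF matrix_vector_mul_bounded_linear i\<delta>])
  note oX = ito_integral_orthogonal[OF itoX \<zeta>] and oY = ito_integral_orthogonal[OF itoY \<zeta>]
  have iR: "integrable M R"
    unfolding R_def[abs_def] using i\<delta> iA oX(1) oY(1) by auto
  have "(\<integral>\<^sup>+\<omega>. ennreal (norm (R \<omega>)) \<partial>M)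
      \<le> (\<integral>\<^sup>+\<omega>. ennreal (norm (?D t \<omega>)) + (ennreal K1 * G a \<omega> + ennreal K2 * G \<alpha> \<omega>) \<partial>M)"
    by (rule nn_integral_mono_AE[OF pathwise])
  also have "\<dots> = (\<integral>\<^sup>+\<omega>. ennreal (norm (?D t \<omega>)) \<partial>M) + (ennreal K1 * (\<integral>\<^sup>+\<omega>. G a \<omega> \<partial>M) + ennreal K2 * (\<integral>\<^sup>+\<omega>. G \<alpha> \<omega> \<partial>M))"
    using Gm[OF a] Gm[OF \<alpha>(1)] by (simp add: nn_integral_add nn_integral_cmult)
  also have "\<dots> \<le> ennreal (C * t powr (- l)) + (ennreal K1 * ennreal (C * Beta (1 - l) a * t powr (a - l))
      + ennreal K2 * ennreal (C * Beta (1 - l) \<alpha> * t powr (\<alpha> - l)))"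
    using t by (intro add_mono mult_left_mono bd Gi a \<alpha>) auto
  also have "\<dots> = ennreal Q"
    using C K0 B0[OF a] B0[OF \<alpha>(1)]
    by (simp add: Q_def ennreal_mult'[symmetric] ennreal_plus[symmetric] del: ennreal_plus)
  finally have "expectation (\<lambda>\<omega>. norm (R \<omega>)) \<le> Q"
    using iR Q0 by (subst (asm) nn_integral_eq_integral) (auto simp: ennreal_le_iff)
  moreover have "expectation (\<lambda>\<omega>. R \<omega> \<bullet> \<zeta> \<omega>)
      = expectation (\<lambda>\<omega>. \<delta> \<omega> \<bullet> \<zeta> \<omega>) - c * expectation (\<lambda>\<omega>. (A *v \<delta> \<omega>) \<bullet> \<zeta> \<omega>)"
  proof -
    have in\<zeta>: "integrable M (\<lambda>\<omega>. f \<omega> \<bullet> \<zeta> \<omega>)" if "integrable M f" for f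
      using \<zeta>(2) by (intro integrable_inner_bounded(1)[OF that measurable_filtration[OF order_refl \<zeta>(1)]])
    show ?thesis
      unfolding R_def inner_add_left inner_diff_left inner_scaleR_left
      using in\<zeta>[OF i\<delta>] in\<zeta>[OF iA] in\<zeta>[OF oX(1)] in\<zeta>[OF oY(1)] oX(2) oY(2) by simp
  qed
  moreover have "\<bar>expectation (\<lambda>\<omega>. R \<omega> \<bullet> \<zeta> \<omega>)\<bar> \<le> 1 * expectation (\<lambda>\<omega>. norm (R \<omega>))"
    using \<zeta>(2) by (intro integrable_inner_bounded(2)[OF iR measurable_filtration[OF order_refl \<zeta>(1)]])
  ultimately show ?thesis
    unfolding \<delta>_def c_def Q_def K1_def K2_def a_def by simp
qed

end

section \<open>Asymptotic separation\<close>

theorem theorem5p1: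
  fixes M :: "'w measure" and F :: "real \<Rightarrow> 'w measure" and W :: "real \<Rightarrow> 'w \<Rightarrow> real"
    and \<alpha> \<beta> \<epsilon> L_b L_\<sigma> :: real
    and A B :: "real^'n^'n"
    and b \<sigma> :: "real \<Rightarrow> real^'n \<Rightarrow> real^'n"
    and \<phi> :: "('w \<Rightarrow> real^'n) \<Rightarrow> real \<Rightarrow> 'w \<Rightarrow> real^'n"
    and \<eta> \<gamma> :: "'w \<Rightarrow> real^'n"
  assumes "brownian_basis M F W"
    and "1 / 2 < \<alpha>" "\<alpha> < 1" "0 < \<beta>" "\<beta> < 1"
    and "A ** B \<noteq> B ** A"
    and "(\<lambda>(t, x). b t x) \<in> borel_measurable (restrict_space borel ({0..} \<times> UNIV))"
    and "(\<lambda>(t, x). \<sigma> t x) \<in> borel_measurable (restrict_space borel ({0..} \<times> UNIV))"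
    and "bounded ((\<lambda>(t, x). b t x) ` ({0..} \<times> UNIV))"
    and "bounded ((\<lambda>(t, x). \<sigma> t x) ` ({0..} \<times> UNIV))"
    and "L_b > 0" "L_\<sigma> > 0"
    and "\<And>t x y. 0 \<le> t \<Longrightarrow> norm (b t x - b t y) \<le> L_b * norm (x - y)"
    and "\<And>t x y. 0 \<le> t \<Longrightarrow> norm (\<sigma> t x - \<sigma> t y) \<le> L_\<sigma> * norm (x - y)"
    and "\<And>T. 0 < T \<Longrightarrow> (\<integral>\<^sup>+r\<in>{0..T}. ennreal ((norm (b r 0))\<^sup>2) \<partial>lborel) < \<infinity>"
    and "\<And>T. 0 < T \<Longrightarrow> esssup (restrict_space lborel {0..T}) (\<lambda>r. ereal (norm (\<sigma> r 0))) < \<infinity>"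
    and "\<eta> \<in> Xi M F 0" "\<gamma> \<in> Xi M F 0"
    and "\<not> (AE \<omega> in M. \<eta> \<omega> = \<gamma> \<omega>)"
    and "mild_solution M F W \<alpha> \<beta> A B b \<sigma> \<eta> (\<phi> \<eta>)"
    and "mild_solution M F W \<alpha> \<beta> A B b \<sigma> \<gamma> (\<phi> \<gamma>)"
    and "\<epsilon> > 0"
  shows "Limsup at_top (\<lambda>t. ereal (t powr (\<alpha> + \<epsilon>) * ms_norm M (\<lambda>\<omega>. \<phi> \<eta> t \<omega> - \<phi> \<gamma> t \<omega>))) = \<infinity>"
proof (rule ccontr)
  interpret brownian_basis M F W by fact
  note \<alpha> = \<open>1 / 2 < \<alpha>\<close> \<open>\<alpha> < 1\<close> and \<beta> = \<open>0 < \<beta>\<close>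
  note solX = \<open>mild_solution M F W \<alpha> \<beta> A B b \<sigma> \<eta> (\<phi> \<eta>)\<close>[unfolded mild_solution_def, rule_format]
  note solY = \<open>mild_solution M F W \<alpha> \<beta> A B b \<sigma> \<gamma> (\<phi> \<gamma>)\<close>[unfolded mild_solution_def, rule_format]
  note Xi = \<open>\<eta> \<in> Xi M F 0\<close> \<open>\<gamma> \<in> Xi M F 0\<close>
  assume fin: "Limsup at_top (\<lambda>t. ereal (t powr (\<alpha> + \<epsilon>) * ms_norm M (\<lambda>\<omega>. \<phi> \<eta> t \<omega> - \<phi> \<gamma> t \<omega>))) \<noteq> \<infinity>"
  define \<delta> where "\<delta> \<omega> = \<eta> \<omega> - \<gamma> \<omega>" for \<omega>
  \<comment> \<open>The bounded initial variable that turns the pairing with \<open>\<delta>\<close> into the first moment of \<open>\<delta>\<close>.\<close>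
  define \<zeta> where "\<zeta> \<omega> = sgn (\<delta> \<omega>)" for \<omega>
  have F0: "\<eta> \<in> borel_measurable (F 0)" "\<gamma> \<in> borel_measurable (F 0)"
    using Xi by (auto simp: Xi_def)
  then have \<delta>F: "\<delta> \<in> borel_measurable (F 0)"
    unfolding \<delta>_def[abs_def] by simp
  have \<zeta>F: "\<zeta> \<in> borel_measurable (F 0)"
    unfolding \<zeta>_def[abs_def] sgn_div_norm using \<delta>F by simp
  have \<zeta>1: "norm (\<zeta> \<omega>) \<le> 1" for \<omega> by (simp add: \<zeta>_def norm_sgn)
  have i: "integrable M \<eta>" "integrable M \<gamma>"
    using L1_le_L2(1)[of \<eta>] L1_le_L2(1)[of \<gamma>] Xi F0[THEN measurable_filtration[OF order_refl]]
    by (auto simp: Xi_def)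
  have i\<delta>: "integrable M \<delta>" unfolding \<delta>_def[abs_def] using i by simp
  have "expectation (\<lambda>\<omega>. \<delta> \<omega> \<bullet> \<zeta> \<omega>) = 0"
  proof (cases "\<alpha> \<le> \<beta>")
    case True
    have zero: "expectation (\<lambda>\<omega>. \<xi> \<omega> \<bullet> \<zeta> \<omega>) = 0"
      if sol: "mild_solution_on M F W \<alpha> \<beta> A B b \<sigma> \<xi> 1 X" and "integrable M \<xi>" for X \<xi>
    proof -
      have "expectation (\<lambda>\<omega>. X 0 \<omega> \<bullet> \<zeta> \<omega>) = 0"
        using mild_solution_zero_of_singular_kernel[OF sol True]
        by (intro integral_eq_zero_AE) auto
      then show ?thesis
        using projected_initial_value[OF sol _ \<zeta>F \<zeta>1 that(2)] by simp
    qed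
    have in\<zeta>: "integrable M (\<lambda>\<omega>. f \<omega> \<bullet> \<zeta> \<omega>)" if "integrable M f" for f
      by (rule integrable_inner_bounded(1)[OF that measurable_filtration[OF order_refl \<zeta>F] \<zeta>1])
    show ?thesis
      using zero[OF solX i(1)] zero[OF solY i(2)] in\<zeta>[OF i(1)] in\<zeta>[OF i(2)]
      by (simp add: \<delta>_def inner_diff_left)
  next
    case False
    define a where "a = \<alpha> - \<beta>"
    \<comment> \<open>The midpoint lies strictly between \<open>\<alpha>\<close> and both \<open>1\<close> and \<open>\<alpha> + \<epsilon>\<close>.\<close>
    define l where "l = (\<alpha> + min 1 (\<alpha> + \<epsilon>)) / 2"
    have l: "\<alpha> < l" "l < 1" "l \<le> \<alpha> + \<epsilon>" "0 < l"
      using \<alpha> \<open>\<epsilon> > 0\<close> by (auto simp: l_def min_def)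
    have H2: "\<phi> \<eta> \<in> H2 M F T" "\<phi> \<gamma> \<in> H2 M F T" if "0 < T" for T
      using solX[OF that] solY[OF that] by (auto simp: mild_solution_on_def)
    obtain C where C: "0 \<le> C"
      "\<And>r. 0 < r \<Longrightarrow> (\<integral>\<^sup>+\<omega>. ennreal (norm (\<phi> \<eta> r \<omega> - \<phi> \<gamma> r \<omega>)) \<partial>M) \<le> ennreal (C * r powr (- l))"
      using first_moment_power_bound[OF H2 l(4,3) fin] by blast
    define K1 where "K1 = onorm ((*v) A) / Gamma a * (C * Beta (1 - l) a)"
    define K2 where "K2 = (onorm ((*v) B) + L_b) / Gamma \<alpha> * (C * Beta (1 - l) \<alpha>)"
    define q where "q = expectation (\<lambda>\<omega>. (A *v \<delta> \<omega>) \<bullet> \<zeta> \<omega>) / Gamma (a + 1)"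
    show ?thesis
    proof (rule power_balance_zero[of a \<alpha> l _ q "max C (max K1 K2)"])
      fix t :: real assume t: "0 < t"
      have "\<bar>expectation (\<lambda>\<omega>. \<delta> \<omega> \<bullet> \<zeta> \<omega>) - t powr a * q\<bar>
          \<le> C * t powr (- l) + K1 * t powr (a - l) + K2 * t powr (\<alpha> - l)"
        using projected_difference_bound[OF solX[OF t] solY[OF t] Xi t order_refl l(2) C(1), of L_b \<zeta>]
          \<alpha> False C(2) assms(11,13) \<zeta>F \<zeta>1
        by (simp add: \<delta>_def q_def K1_def K2_def a_def mult_ac)
      also have "\<dots> \<le> max C (max K1 K2) * t powr (- l) + max C (max K1 K2) * t powr (a - l)
          + max C (max K1 K2) * t powr (\<alpha> - l)"
        by (intro add_mono mult_right_mono) auto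
      finally show "\<bar>expectation (\<lambda>\<omega>. \<delta> \<omega> \<bullet> \<zeta> \<omega>) - t powr a * q\<bar>
          \<le> max C (max K1 K2) * (t powr (- l) + t powr (a - l) + t powr (\<alpha> - l))"
        by (simp add: distrib_left)
    qed (use False \<beta> l in \<open>auto simp: a_def\<close>)
  qed
  moreover have "\<delta> \<omega> \<bullet> \<zeta> \<omega> = norm (\<delta> \<omega>)" for \<omega>
    by (cases "\<delta> \<omega> = 0") (simp_all add: \<zeta>_def sgn_div_norm power2_norm_eq_inner[symmetric] power2_eq_square)
  ultimately have "expectation (\<lambda>\<omega>. norm (\<delta> \<omega>)) = 0" by simp
  then have "AE \<omega> in M. norm (\<delta> \<omega>) = 0"
    using i\<delta> by (subst (asm) integral_nonneg_eq_0_iff_AE) auto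
  then have "AE \<omega> in M. \<eta> \<omega> = \<gamma> \<omega>" by eventually_elim (simp add: \<delta>_def)
  with \<open>\<not> (AE \<omega> in M. \<eta> \<omega> = \<gamma> \<omega>)\<close> show False by contradiction
qed

end
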